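(* Let $n$ be a positive integer, let $b$ be an integer with $|b|<\lfloor n/2\rfloor$, and let $G$ be a graph on $n$ vertices constructed as follows, where $k$ denotes a positive integer and $b'$ an integer: (1) if $n=4k$ and $b=2b'$: $G$ consists of two complete graphs $G_1,G_2$, each on $2k$ vertices, together with $k-b'$ edges joining vertices of $G_1$ to vertices of $G_2$; (2) if $n=4k+1$ and $b=2b'$: $G$ consists of complete graphs $G_1$ on $2k+1$ vertices and $G_2$ on $2k$ vertices, together with $k-b'$ edges joining vertices of $G_1$ to vertices of $G_2$; (3) if $n=4k+2$ and $b=2b'+1$: $G$ consists of two complete graphs $G_1,G_2$, each on $2k+1$ vertices, together with $k-b'$ edges joining vertices of $G_1$ to vertices of $G_2$; (4) if $n=4k+3$ and $b=2b'+1$: $G$ consists of complete graphs $G_1$ on $2k+2$ vertices and $G_2$ on $2k+1$ vertices, together with $k-b'$ edges joining vertices of $G_1$ to vertices of $G_2$. Then $G$ is a Cohen-Macaulay quasi $f$-graph of type $(0,b)$.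
   Context: Let $G$ have vertex set $V=\{v_1,\dots,v_n\}$, $k_0$ a fixed field, $R=k_0[x_1,\dots,x_n]$, $x_F=\prod_{v_i\in F}x_i$. The edge ideal is $I(G)=(x_ix_j:\{v_i,v_j\}\in E(G))$. $G$ is Cohen-Macaulay if $R/I(G)$ is a Cohen-Macaulay ring. For a square-free monomial ideal $I\subseteq R$ with minimal generating set $G(I)$: the facet complex $\delta_{\mathcal F}(I)$ is the simplicial complex whose facets are the sets $\{v_{i_1},\dots,v_{i_r}\}$ with $x_{i_1}\cdots x_{i_r}\in G(I)$; the non-face complex $\delta_{\mathcal N}(I)$ is $\{F\subseteq V: x_F\notin I\}$. The $f$-vector of a $d$-dimensional complex is $(f_0,\dots,f_d)$, $f_i$ the number of faces with $i+1$ elements. $I$ is a quasi $f$-ideal of type $(a_1,\dots,a_s)\in\mathbb Z^s$ if $f(\delta_{\mathcal N}(I))-f(\delta_{\mathcal F}(I))=(a_1,\dots,a_s)$, both $f$-vectors lying in $\mathbb Z^s$. $G$ is a quasi $f$-graph of type $(0,b)$ if $I(G)$ is a quasi $f$-ideal of type $(0,b)$. *)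

theory Defs
  imports
    Complex_Main
    "HOL-Library.Poly_Mapping"
    "HOL-Library.Extended_Nat"
    "HOL-Algebra.QuotRing"
    "HOL-Algebra.Ring_Divisibility"
begin

section \<open>Cohen-Macaulay rings\<close>

definition regular_sequence :: "('a, 'm) ring_scheme \<Rightarrow> 'a list \<Rightarrow> bool" where
  "regular_sequence R xs \<longleftrightarrow>
     set xs \<subseteq> carrier R \<and>
     genideal R (set xs) \<noteq> carrier R \<and>
     (\<forall>i<length xs. \<forall>y\<in>carrier R.
        xs ! i \<otimes>\<^bsub>R\<^esub> y \<in> genideal R (set (take i xs)) \<longrightarrow> y \<in> genideal R (set (take i xs)))"

definition ideal_depth :: "('a, 'm) ring_scheme \<Rightarrow> 'a set \<Rightarrow> enat" where
  "ideal_depth R I = Sup {enat (length xs) | xs. set xs \<subseteq> I \<and> regular_sequence R xs}"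

definition prime_height :: "('a, 'm) ring_scheme \<Rightarrow> 'a set \<Rightarrow> enat" where
  "prime_height R P = Sup {enat r | r. \<exists>Q :: nat \<Rightarrow> 'a set.
     (\<forall>i\<le>r. primeideal (Q i) R) \<and> (\<forall>i<r. Q i \<subset> Q (Suc i)) \<and> Q r = P}"

text \<open>
  This is the definition of Eisenbud, Commutative Algebra, Section 18.2: a (commutative)
  Noetherian ring in which every maximal ideal has depth equal to its codimension (height).
\<close>

definition cohen_macaulay_ring :: "('a, 'm) ring_scheme \<Rightarrow> bool" where
  "cohen_macaulay_ring R \<longleftrightarrow>
     cring R \<and> noetherian_ring R \<and>
     (\<forall>P. maximalideal P R \<longrightarrow> ideal_depth R P = prime_height R P)"


section \<open>Monomial ideals in a polynomial ring\<close>

type_synonym ('v, 'k) mpoly = "('v \<Rightarrow>\<^sub>0 nat) \<Rightarrow>\<^sub>0 'k"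

text \<open>The ring \<open>k\<^sub>0[x\<^sub>v : v \<in> V]\<close>; the coefficient field is the type \<open>'k\<close>.\<close>

definition poly_ring :: "'v set \<Rightarrow> ('v, 'k::field) mpoly ring" where
  "poly_ring V =
     \<lparr>carrier = {p. \<forall>m\<in>Poly_Mapping.keys p. Poly_Mapping.keys m \<subseteq> V},
      monoid.mult = (*), one = 1, zero = 0, add = (+)\<rparr>"

definition monomials :: "'v set \<Rightarrow> ('v, 'k::field) mpoly set" where
  "monomials V = {Poly_Mapping.single m 1 | m. Poly_Mapping.keys m \<subseteq> V}"

definition xvar :: "'v \<Rightarrow> ('v, 'k::field) mpoly" where
  "xvar v = Poly_Mapping.single (Poly_Mapping.single v 1) 1"

definition xprod :: "'v set \<Rightarrow> ('v, 'k::field) mpoly" where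
  "xprod F = (\<Prod>v\<in>F. xvar v)"

definition squarefree_monomial_ideal :: "'v set \<Rightarrow> ('v, 'k::field) mpoly set \<Rightarrow> bool" where
  "squarefree_monomial_ideal V I \<longleftrightarrow> (\<exists>A \<subseteq> Pow V. I = genideal (poly_ring V) (xprod ` A))"

text \<open>
  \<open>G(I)\<close>: a monomial ideal has exactly one generating set that consists of monomials and is
  minimal with respect to inclusion.
\<close>

definition min_gens :: "'v set \<Rightarrow> ('v, 'k::field) mpoly set \<Rightarrow> ('v, 'k) mpoly set" where
  "min_gens V I = (THE M. M \<subseteq> monomials V \<and> genideal (poly_ring V) M = I \<and>
                          (\<forall>M'. M' \<subset> M \<longrightarrow> genideal (poly_ring V) M' \<noteq> I))"


section \<open>Facet complex, non-face complex and quasi f-ideals\<close>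

definition facet_complex :: "'v set \<Rightarrow> ('v, 'k::field) mpoly set \<Rightarrow> 'v set set" where
  "facet_complex V I = {A. \<exists>F \<subseteq> V. xprod F \<in> min_gens V I \<and> A \<subseteq> F}"

definition nonface_complex :: "'v set \<Rightarrow> ('v, 'k::field) mpoly set \<Rightarrow> 'v set set" where
  "nonface_complex V I = {F. F \<subseteq> V \<and> xprod F \<notin> I}"

text \<open>
  The list \<open>[f\<^sub>0, \<dots>, f\<^sub>d]\<close>, where the largest face has \<open>d + 1\<close> elements. The inserted \<open>0\<close> only
  matters for the void complex, whose f-vector is then empty, like that of \<open>{\<emptyset>}\<close>.
\<close>

definition f_vector :: "'v set set \<Rightarrow> int list" where
  "f_vector D = map (\<lambda>i. int (card {F \<in> D. card F = i + 1})) [0..<Max (insert 0 (card ` D))]"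

definition quasi_f_ideal :: "'v set \<Rightarrow> ('v, 'k::field) mpoly set \<Rightarrow> int list \<Rightarrow> bool" where
  "quasi_f_ideal V I a \<longleftrightarrow>
     squarefree_monomial_ideal V I \<and>
     length (f_vector (nonface_complex V I)) = length a \<and>
     length (f_vector (facet_complex V I)) = length a \<and>
     map2 (-) (f_vector (nonface_complex V I)) (f_vector (facet_complex V I)) = a"


section \<open>Graphs\<close>

definition complete_edges :: "'v set \<Rightarrow> 'v set set" where
  "complete_edges V = {e. e \<subseteq> V \<and> card e = 2}"

definition simple_graph :: "'v set \<Rightarrow> 'v set set \<Rightarrow> bool" where
  "simple_graph V E \<longleftrightarrow> finite V \<and> E \<subseteq> complete_edges V"

definition edge_ideal :: "'v set \<Rightarrow> 'v set set \<Rightarrow> ('v, 'k::field) mpoly set" where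
  "edge_ideal V E = genideal (poly_ring V) {xvar u * xvar v | u v. {u, v} \<in> E}"

definition cohen_macaulay_graph :: "'k::field itself \<Rightarrow> 'v set \<Rightarrow> 'v set set \<Rightarrow> bool" where
  "cohen_macaulay_graph _ V E \<longleftrightarrow>
     cohen_macaulay_ring (poly_ring V Quot (edge_ideal V E :: ('v, 'k) mpoly set))"

definition quasi_f_graph :: "'k::field itself \<Rightarrow> 'v set \<Rightarrow> 'v set set \<Rightarrow> int list \<Rightarrow> bool" where
  "quasi_f_graph _ V E a \<longleftrightarrow> quasi_f_ideal V (edge_ideal V E :: ('v, 'k) mpoly set) a"

text \<open>
  Two disjoint complete graphs on \<open>p\<close> and \<open>q\<close> vertices together with \<open>c\<close> (distinct, otherwise
  arbitrary) edges joining a vertex of the first to a vertex of the second.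
\<close>

definition joined_complete_graphs :: "nat \<Rightarrow> nat \<Rightarrow> int \<Rightarrow> 'v set \<Rightarrow> 'v set set \<Rightarrow> bool" where
  "joined_complete_graphs p q c V E \<longleftrightarrow>
     (\<exists>V1 V2 C. V = V1 \<union> V2 \<and> V1 \<inter> V2 = {} \<and>
        finite V1 \<and> finite V2 \<and> card V1 = p \<and> card V2 = q \<and>
        C \<subseteq> {{u, v} | u v. u \<in> V1 \<and> v \<in> V2} \<and> int (card C) = c \<and>
        E = complete_edges V1 \<union> complete_edges V2 \<union> C)"

end

(*
The independence complex of G is the bipartite graph of the non-edges {u, v} between the two
cliques V1 and V2. It is one-dimensional, has no isolated vertices, and any two vertices of V1 have a
common neighbour in it, because fewer than min(|V1|, |V2|) pairs are edges of G.

Cohen-Macaulayness. Put A = R/I(G), theta1 = the sum of the variables in V1 and theta2 = the sum of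
those in V2. The ring A consists of the families of elements of K[x_u, x_v], one for each non-edge
{u, v}, that agree where two non-edges meet, and on every non-edge theta1, theta2 restrict to x_u, x_v.
So every prime of A comes from a copy of K[s, t], which bounds the heights by 2; every maximal
ideal contains some p(theta1) and q(theta2) with p, q nonzero, and these form a regular sequence
because K[s, t] has this property for p(s), q(t) and quotients of compatible families by p(s) are
compatible. Since depth <= height in any commutative ring, both are 2. Noetherianity follows from that
of K[s, t], one non-edge at a time.

The f-vectors. Both complexes have |V| vertices; the edges are the non-edges of G in one and the edges
of G in the other.
*)
theory Submission
  imports Defs "HOL-Computational_Algebra.Polynomial"
begin

hide_const (open) UnivPoly.coeff UnivPoly.monom Poly_Mapping.degree

section \<open>Depth and height\<close>

text \<open>Every maximal ideal must be tested, over an arbitrary field, so none need contain theta1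
  - a for a scalar a; nonzero polynomials p(theta1), q(theta2) replace linear forms. This has a
  price: p may vanish at 0, so where two non-edges share their vertex in V2, compatibility of the
  quotient by p(s) cannot be obtained by cancelling p after setting s = 0. It comes from the other
  side of the relation q f = p g, where g is q(t) times the same quotient. Two disjoint non-edges
  meet only in the constant term, and their constant terms are compared in two steps through a
  common neighbour. This is where connectedness of the independence complex enters. The single
  substitution g |-> g(theta1, theta2) is a right inverse of the restrictions to all non-edges at
  once, which lets ideals of A be contracted to K[s, t] and coefficients from K[s, t] act on A. Let
  r be the size of the smaller clique and c the number of joining edges. In all four cases r is the
  integer part of n/2 and b = r - 2c, so the bound on |b| says exactly 0 < c < r.\<close>

text \<open>An ideal maximal among those avoiding \<open>T\<close> is prime: if a and b lie outside
  it, enlarging it by either one meets \<open>T\<close>, and the product of the two elements of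
  \<open>T\<close> so found would fall back into the ideal if a b did.\<close>

lemma (in cring) exists_primeideal_disjoint:
  assumes J: "ideal J R" and T: "T \<subseteq> carrier R" "\<one> \<in> T" "\<And>x y. x \<in> T \<Longrightarrow> y \<in> T \<Longrightarrow> x \<otimes> y \<in> T"
    and disj: "J \<inter> T = {}"
  shows "\<exists>P. primeideal P R \<and> J \<subseteq> P \<and> P \<inter> T = {}"
proof -
  define A where "A = {I. ideal I R \<and> J \<subseteq> I \<and> I \<inter> T = {}}"
  have "\<exists>M\<in>A. \<forall>X\<in>A. M \<subseteq> X \<longrightarrow> X = M"
  proof (rule subset_Zorn_nonempty)
    show "A \<noteq> {}"
      using J disj by (auto simp: A_def)
    fix C assume C: "C \<noteq> {}" "subset.chain A C"
    then have "subset.chain {I. ideal I R} C"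
      by (auto simp: pred_on.chain_def A_def)
    then have "ideal (\<Union>C) R"
      using chain_Union_is_ideal[of C] C(1) by simp
    moreover have "C \<subseteq> A"
      using C(2) by (simp add: pred_on.chain_def)
    ultimately show "\<Union>C \<in> A"
      using C(1) by (auto simp: A_def)
  qed
  then obtain M where MA: "M \<in> A" and maxA: "\<forall>X\<in>A. M \<subseteq> X \<longrightarrow> X = M"
    by blast
  have M: "ideal M R" "J \<subseteq> M" "M \<inter> T = {}"
    using MA by (simp_all add: A_def)
  have max: "X = M" if "ideal X R" "M \<subseteq> X" "X \<inter> T = {}" for X
    using maxA that M(2) by (auto simp: A_def)
  interpret M: ideal M R
    by (rule M(1))
  have meets: "\<exists>m\<in>M. \<exists>x\<in>carrier R. m \<oplus> x \<otimes> a \<in> T" if "a \<in> carrier R" "a \<notin> M" for a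
  proof -
    let ?X = "M <+>\<^bsub>R\<^esub> PIdl a"
    have X: "ideal ?X R"
      using M(1) that(1) by (intro add_ideals cgenideal_ideal)
    have "M \<subseteq> ?X"
    proof
      fix m assume m: "m \<in> M"
      have "\<zero> \<in> PIdl a"
        using that(1) by (metis additive_subgroup.zero_closed cgenideal_ideal ideal.axioms(1))
      then show "m \<in> ?X"
        using m M.Icarr[OF m] r_zero[of m] unfolding set_add_def' by (intro UN_I[of m] UN_I[of \<zero>]) auto
    qed
    have "a \<in> PIdl a"
      using that(1) by (rule cgenideal_self)
    then have "a \<in> ?X"
      using that(1) M.zero_closed l_zero[of a] unfolding set_add_def'
      by (intro UN_I[of \<zero>] UN_I[of a]) auto
    then have "?X \<inter> T \<noteq> {}"
      using max[OF X \<open>M \<subseteq> ?X\<close>] that(2) by auto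
    then show ?thesis
      by (auto simp: set_add_def' cgenideal_def)
  qed
  have "primeideal M R"
  proof (rule primeidealI[OF M(1) is_cring])
    show "carrier R \<noteq> M"
      using M(3) T(2) by auto
    fix a b assume ab: "a \<in> carrier R" "b \<in> carrier R" "a \<otimes> b \<in> M"
    show "a \<in> M \<or> b \<in> M"
    proof (rule ccontr)
      assume "\<not> (a \<in> M \<or> b \<in> M)"
      then obtain m x n y where m: "m \<in> M" "x \<in> carrier R" "m \<oplus> x \<otimes> a \<in> T"
        and n: "n \<in> M" "y \<in> carrier R" "n \<oplus> y \<otimes> b \<in> T"
        using meets[OF ab(1)] meets[OF ab(2)] by blast
      have "(m \<oplus> x \<otimes> a) \<otimes> (n \<oplus> y \<otimes> b) = m \<otimes> (n \<oplus> y \<otimes> b) \<oplus> (x \<otimes> a) \<otimes> n \<oplus> (x \<otimes> y) \<otimes> (a \<otimes> b)"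
        using M.Icarr[OF m(1)] M.Icarr[OF n(1)] m(2) n(2) ab(1,2) by algebra
      also have "\<dots> \<in> M"
        using M.Icarr[OF m(1)] M.Icarr[OF n(1)] m n ab
        by (intro M.a_closed M.I_r_closed[OF m(1)] M.I_l_closed[OF n(1)] M.I_l_closed[OF ab(3)]) auto
      finally show False
        using T(3)[OF m(3) n(3)] M(3) by blast
    qed
  qed
  with M show ?thesis
    by blast
qed

text \<open>
  Each term of a regular sequence is a non-zerodivisor modulo the previous ones; hence some prime
  over the previous ones, contained in the given prime, avoids it.
\<close>

lemma (in cring) regular_sequence_prime_chain:
  assumes reg: "regular_sequence R xs" and i: "i \<le> length xs"
    and P: "primeideal P R" "set (take i xs) \<subseteq> P"
  shows "\<exists>Q. (\<forall>j\<le>i. primeideal (Q j) R) \<and> (\<forall>j<i. Q j \<subset> Q (Suc j)) \<and> Q i = P"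
  using i P
proof (induction i arbitrary: P)
  case 0
  then show ?case
    by (intro exI[of _ "\<lambda>_. P"]) simp
next
  case (Suc i)
  interpret P: primeideal P R
    by (rule Suc.prems(2))
  define x where "x = xs ! i"
  define J where "J = Idl (set (take i xs))"
  have xs: "set xs \<subseteq> carrier R"
    using reg by (simp add: regular_sequence_def)
  then have x: "x \<in> carrier R"
    using Suc.prems(1) nth_mem[of i xs] unfolding x_def by force
  have gens: "set (take i xs) \<subseteq> carrier R"
    using xs set_take_subset[of i xs] by blast
  have J: "ideal J R"
    unfolding J_def using gens by (rule genideal_ideal)
  have "set (take i xs) \<subseteq> P"
    using Suc.prems(1,3) by (simp add: take_Suc_conv_app_nth)
  then have JP: "J \<subseteq> P"
    unfolding J_def by (intro genideal_minimal P.is_ideal)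
  have nzd: "y \<in> J" if "y \<in> carrier R" "x \<otimes> y \<in> J" for y
  proof -
    have "\<forall>i<length xs. \<forall>y\<in>carrier R. xs ! i \<otimes> y \<in> Idl (set (take i xs)) \<longrightarrow> y \<in> Idl (set (take i xs))"
      using reg by (simp add: regular_sequence_def)
    from this[rule_format, of i y] show ?thesis
      using that Suc.prems(1) by (simp add: x_def J_def)
  qed
  have nzd_pow: "y \<in> J" if "y \<in> carrier R" "x [^] n \<otimes> y \<in> J" for y and n :: nat
    using that
  proof (induction n arbitrary: y)
    case (Suc n)
    have "x [^] n \<otimes> (x \<otimes> y) \<in> J"
      using Suc.prems x m_assoc[of "x [^] n" x y] by simp
    then have "x \<otimes> y \<in> J"
      using Suc.IH[of "x \<otimes> y"] Suc.prems(1) x by simp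
    then show ?case
      using nzd Suc.prems(1) by blast
  qed simp
  \<comment> \<open>Avoiding \<open>T\<close> achieves two things at once: the factor s outside
    \<open>P\<close> forces the new prime into \<open>P\<close>, and the powers of x keep x out of
    it.\<close>
  define T where "T = {x [^] n \<otimes> s | (n::nat) s. s \<in> carrier R \<and> s \<notin> P}"
  have one: "\<one> \<notin> P"
    using P.I_notcarr P.one_imp_carrier by auto
  have "\<exists>P'. primeideal P' R \<and> J \<subseteq> P' \<and> P' \<inter> T = {}"
  proof (rule exists_primeideal_disjoint[OF J])
    show "T \<subseteq> carrier R"
      using x by (auto simp: T_def)
    show "\<one> \<in> T"
      unfolding T_def using one by (intro CollectI exI[of _ "0::nat"] exI[of _ \<one>]) simp
    show "J \<inter> T = {}"
      using nzd_pow JP by (auto simp: T_def)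
    fix a b assume "a \<in> T" "b \<in> T"
    then obtain n s m t where *: "a = x [^] (n::nat) \<otimes> s" "s \<in> carrier R" "s \<notin> P"
      "b = x [^] (m::nat) \<otimes> t" "t \<in> carrier R" "t \<notin> P"
      by (auto simp: T_def)
    have "a \<otimes> b = (x [^] n \<otimes> x [^] m) \<otimes> (s \<otimes> t)"
      using * x by (simp add: m_ac)
    also have "x [^] n \<otimes> x [^] m = x [^] (n + m)"
      using x by (simp add: nat_pow_mult)
    finally have "a \<otimes> b = x [^] (n + m) \<otimes> (s \<otimes> t)" .
    moreover have "s \<otimes> t \<notin> P"
      using P.I_prime * by blast
    ultimately show "a \<otimes> b \<in> T"
      unfolding T_def using * by blast
  qed
  then obtain P' where P': "primeideal P' R" "J \<subseteq> P'" "P' \<inter> T = {}"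
    by blast
  have "P' \<subseteq> P"
  proof
    fix s assume s: "s \<in> P'"
    then have carr: "s \<in> carrier R"
      using P'(1) ideal.Icarr primeideal.axioms(1) by metis
    show "s \<in> P"
    proof (rule ccontr)
      assume "s \<notin> P"
      then have "s \<in> T"
        unfolding T_def using carr by (intro CollectI exI[of _ "0::nat"] exI[of _ s]) simp
      then show False
        using s P'(3) by blast
    qed
  qed
  moreover have "x \<in> T"
    unfolding T_def using one x by (intro CollectI exI[of _ "1::nat"] exI[of _ \<one>]) simp
  then have "x \<notin> P'"
    using P'(3) by blast
  moreover have "x \<in> P"
    using Suc.prems(1,3) by (auto simp: x_def take_Suc_conv_app_nth)
  ultimately have "P' \<subset> P"
    by blast
  have "set (take i xs) \<subseteq> P'"
    using P'(2) genideal_self[OF gens] by (auto simp: J_def)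
  then obtain Q where Q: "\<forall>j\<le>i. primeideal (Q j) R" "\<forall>j<i. Q j \<subset> Q (Suc j)" "Q i = P'"
    using Suc.IH[OF _ P'(1)] Suc.prems(1) by auto
  then show ?case
    using \<open>P' \<subset> P\<close> Suc.prems(2)
    by (intro exI[of _ "Q(Suc i := P)"]) (auto simp: le_Suc_eq less_Suc_eq)
qed

lemma (in cring) ideal_depth_le_prime_height:
  assumes "primeideal P R"
  shows "ideal_depth R P \<le> prime_height R P"
  unfolding ideal_depth_def
proof (rule Sup_least, clarify)
  fix xs assume xs: "set xs \<subseteq> P" "regular_sequence R xs"
  show "enat (length xs) \<le> prime_height R P"
    unfolding prime_height_def
    using regular_sequence_prime_chain[OF xs(2) order_refl assms] xs(1)
    by (intro Sup_upper) auto
qed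

text \<open>A longer chain is cut off after d + 1 steps. The piece need not end at \<open>P\<close>,
  so the hypothesis speaks of all chains and the bound is uniform in \<open>P\<close>.\<close>

lemma prime_height_le:
  assumes "\<And>Q :: nat \<Rightarrow> 'a set. (\<And>i. i \<le> Suc d \<Longrightarrow> primeideal (Q i) R) \<Longrightarrow>
    (\<And>i. i < Suc d \<Longrightarrow> Q i \<subset> Q (Suc i)) \<Longrightarrow> False"
  shows "prime_height R P \<le> enat d"
  unfolding prime_height_def
proof (rule Sup_least, clarify)
  fix r and Q :: "nat \<Rightarrow> 'a set"
  assume Q: "\<forall>i\<le>r. primeideal (Q i) R" "\<forall>i<r. Q i \<subset> Q (Suc i)"
  show "enat r \<le> enat d"
  proof (rule ccontr)
    assume "\<not> ?thesis"
    then have "Suc d \<le> r"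
      by simp
    then show False
      using assms[of Q] Q by auto
  qed
qed

text \<open>Membership in the ideals generated by nothing and by \<open>a\<close> is spelled out as
  equations, which can be tested on representatives in a quotient. The ideal \<open>M\<close>
  certifies that \<open>a\<close> and \<open>b\<close> generate a proper ideal.\<close>

lemma (in cring) regular_sequence_pair:
  assumes carr: "a \<in> carrier R" "b \<in> carrier R"
    and M: "ideal M R" "M \<noteq> carrier R" "a \<in> M" "b \<in> M"
    and a: "\<And>y. y \<in> carrier R \<Longrightarrow> a \<otimes> y = \<zero> \<Longrightarrow> y = \<zero>"
    and b: "\<And>y z. y \<in> carrier R \<Longrightarrow> z \<in> carrier R \<Longrightarrow> b \<otimes> y = a \<otimes> z \<Longrightarrow> \<exists>w\<in>carrier R. y = a \<otimes> w"
  shows "regular_sequence R [a, b]"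
  unfolding regular_sequence_def
proof (intro conjI allI impI ballI)
  show "set [a, b] \<subseteq> carrier R"
    using carr by simp
  have "Idl (set [a, b]) \<subseteq> M"
    using M by (intro genideal_minimal) auto
  then show "Idl (set [a, b]) \<noteq> carrier R"
    using M(1,2) by (metis ideal.Icarr subsetI subset_antisym)
  fix i y assume i: "i < length [a, b]" and y: "y \<in> carrier R"
    and mem: "[a, b] ! i \<otimes> y \<in> Idl (set (take i [a, b]))"
  have Idl0: "Idl {} = {\<zero>}"
    using genideal_minimal[OF zeroideal, of "{}"] genideal_ideal[of "{}"]
    by (auto dest: ideal.axioms(1) additive_subgroup.zero_closed)
  have Idla: "Idl {a} = {x \<otimes> a | x. x \<in> carrier R}"
    using cgenideal_eq_genideal[OF carr(1)] by (simp add: cgenideal_def)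
  consider "i = 0" | "i = 1"
    using i by fastforce
  then show "y \<in> Idl (set (take i [a, b]))"
  proof cases
    case 1
    then show ?thesis
      using mem a y by (simp add: Idl0)
  next
    case 2
    then obtain z where z: "z \<in> carrier R" "b \<otimes> y = a \<otimes> z"
      using mem carr(1) by (auto simp: Idla m_comm)
    then obtain w where "w \<in> carrier R" "y = a \<otimes> w"
      using b y by blast
    then show ?thesis
      using 2 carr(1) by (auto simp: Idla m_comm[of a w])
  qed
qed

lemma cohen_macaulay_ringI_dim_2:
  assumes R: "cring R" "noetherian_ring R"
    and reg: "\<And>M. maximalideal M R \<Longrightarrow> \<exists>a b. a \<in> M \<and> b \<in> M \<and> regular_sequence R [a, b]"
    and dim: "\<And>Q :: nat \<Rightarrow> 'a set. (\<And>i. i \<le> 3 \<Longrightarrow> primeideal (Q i) R) \<Longrightarrow>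
      (\<And>i. i < 3 \<Longrightarrow> Q i \<subset> Q (Suc i)) \<Longrightarrow> False"
  shows "cohen_macaulay_ring R"
  unfolding cohen_macaulay_ring_def
proof (intro conjI allI impI R)
  fix M assume M: "maximalideal M R"
  obtain a b where ab: "a \<in> M" "b \<in> M" "regular_sequence R [a, b]"
    using reg[OF M] by blast
  have "enat 2 \<le> ideal_depth R M"
    unfolding ideal_depth_def
    by (rule Sup_upper, rule CollectI, rule exI[of _ "[a, b]"]) (use ab in \<open>simp add: numeral_2_eq_2\<close>)
  moreover have "ideal_depth R M \<le> prime_height R M"
    by (intro cring.ideal_depth_le_prime_height R cring.maximalideal_prime M)
  moreover have "prime_height R M \<le> enat 2"
  proof (rule prime_height_le)
    fix Q :: "nat \<Rightarrow> 'a set"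
    assume "\<And>i. i \<le> Suc 2 \<Longrightarrow> primeideal (Q i) R" "\<And>i. i < Suc 2 \<Longrightarrow> Q i \<subset> Q (Suc i)"
    then show False
      by (intro dim[of Q]) simp_all
  qed
  ultimately show "ideal_depth R M = prime_height R M"
    by (meson antisym order.trans)
qed

section \<open>Substitution homomorphisms\<close>

text \<open>Homomorphisms between whole types, so that type-class algebra applies; the carrier of
  \<open>poly_ring V\<close> enters only through separate closure lemmas.\<close>

definition ring_morph :: "('a::comm_ring_1 \<Rightarrow> 'b::comm_ring_1) \<Rightarrow> bool" where
  "ring_morph h \<longleftrightarrow> (\<forall>x y. h (x + y) = h x + h y) \<and> (\<forall>x y. h (x * y) = h x * h y) \<and> h 1 = 1"

lemma ring_morphD:
  assumes "ring_morph h"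
  shows "h (x + y) = h x + h y" "h (x * y) = h x * h y" "h 1 = 1" "h 0 = 0"
    "h (- x) = - h x" "h (x - y) = h x - h y" "h (x ^ n) = h x ^ n" "h (sum f A) = (\<Sum>a\<in>A. h (f a))"
proof -
  have add: "h (x + y) = h x + h y" for x y
    using assms by (simp add: ring_morph_def)
  then interpret additive h
    by unfold_locales
  have mult: "h (x * y) = h x * h y" for x y
    using assms by (simp add: ring_morph_def)
  have one: "h 1 = 1"
    using assms by (simp add: ring_morph_def)
  show "h (x + y) = h x + h y" "h (x * y) = h x * h y" "h 1 = 1" "h 0 = 0"
    "h (- x) = - h x" "h (x - y) = h x - h y" "h (sum f A) = (\<Sum>a\<in>A. h (f a))"
    by (rule add mult one zero minus diff sum)+
  show "h (x ^ n) = h x ^ n"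
    by (induction n) (simp_all add: one mult)
qed

text \<open>The extension of \<open>h\<close> to polynomials that sends the variable to
  \<open>x\<close>, as in the universal property of a polynomial ring.\<close>

definition subst_poly :: "('a::comm_ring_1 \<Rightarrow> 'b::comm_ring_1) \<Rightarrow> 'b \<Rightarrow> 'a poly \<Rightarrow> 'b" where
  "subst_poly h x p = poly (map_poly h p) x"

lemma subst_poly_pCons:
  assumes "h 0 = 0"
  shows "subst_poly h x (pCons a p) = h a + x * subst_poly h x p"
  using assms by (simp add: subst_poly_def map_poly_pCons)

lemma subst_poly_0 [simp]: "subst_poly h x 0 = 0"
  by (simp add: subst_poly_def)

lemma subst_poly_const: "h 0 = 0 \<Longrightarrow> subst_poly h x [:a:] = h a"
  by (simp add: subst_poly_pCons)

lemma subst_poly_add: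
  assumes "h 0 = 0" "\<And>x y. h (x + y) = h x + h y"
  shows "subst_poly h x (p + q) = subst_poly h x p + subst_poly h x q"
proof (induction p arbitrary: q)
  case (pCons a p)
  then show ?case
    by (cases q) (simp add: subst_poly_pCons assms algebra_simps)
qed simp

lemma ring_morph_subst_poly:
  assumes "ring_morph h"
  shows "ring_morph (subst_poly h x)"
proof -
  note h = ring_morphD[OF assms]
  have add: "subst_poly h x (p + q) = subst_poly h x p + subst_poly h x q" for p q
    by (rule subst_poly_add) (simp_all add: h)
  have smult: "subst_poly h x (smult a p) = h a * subst_poly h x p" for a p
    by (induction p) (simp_all add: subst_poly_pCons h algebra_simps)
  have "subst_poly h x (p * q) = subst_poly h x p * subst_poly h x q" for p q
    by (induction p) (simp_all add: subst_poly_pCons h add smult mult_pCons_left algebra_simps)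
  moreover have "subst_poly h x 1 = 1"
    by (simp add: subst_poly_def h)
  ultimately show ?thesis
    using add by (simp add: ring_morph_def)
qed

text \<open>The substitution \<open>s \<mapsto> a\<close>, \<open>t \<mapsto> b\<close> on \<open>R[s][t]\<close>; \<open>t\<close> is the outer variable.\<close>

definition subst2 :: "('a::comm_ring_1 \<Rightarrow> 'b::comm_ring_1) \<Rightarrow> 'b \<Rightarrow> 'b \<Rightarrow> 'a poly poly \<Rightarrow> 'b" where
  "subst2 h a b = subst_poly (subst_poly h a) b"

lemma ring_morph_subst2: "ring_morph h \<Longrightarrow> ring_morph (subst2 h a b)"
  unfolding subst2_def by (intro ring_morph_subst_poly)

lemma subst2_const: "ring_morph h \<Longrightarrow> subst2 h a b [:p:] = subst_poly h a p"
  by (simp add: subst2_def subst_poly_const)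

text \<open>Embedding the coefficients of \<open>q\<close> as constants writes \<open>q\<close> in
  the outer variable t, whereas \<open>[:p:]\<close> is \<open>p\<close> in the inner variable s.
  These are the two ways in which q(t) and p(s) appear below.\<close>

lemma subst2_inner_const:
  assumes "ring_morph h"
  shows "subst2 h a b (map_poly (\<lambda>c. [:c:]) q) = subst_poly h b q"
  unfolding subst2_def
  using ring_morphD(4)[OF assms]
  by (induction q) (simp_all add: map_poly_pCons subst_poly_pCons subst_poly_const)


section \<open>Maximal ideals of \<open>K[s][t]\<close>\<close>

text \<open>
  Let \<open>f\<close> be an element of least degree in \<open>t\<close>, with leading coefficient \<open>a(s)\<close>. If the ideal met
  \<open>K[s]\<close> only in \<open>0\<close>, then inverting \<open>1 + s a\<close> modulo the ideal and reducing modulo \<open>f\<close> would show that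
  \<open>1 + s a\<close> divides a power of \<open>a\<close>, to which it is coprime.
\<close>

lemma maximal_ideal_contains_const:
  fixes m :: "'k::field poly poly set"
  assumes add: "\<And>x y. x \<in> m \<Longrightarrow> y \<in> m \<Longrightarrow> x + y \<in> m"
    and mult: "\<And>x y. x \<in> m \<Longrightarrow> y * x \<in> m"
    and inv: "\<And>x. x \<notin> m \<Longrightarrow> \<exists>y. x * y - 1 \<in> m"
    and proper: "1 \<notin> m"
  shows "\<exists>p. p \<noteq> 0 \<and> [:p:] \<in> m"
proof (rule ccontr)
  assume "\<not> ?thesis"
  then have none: "p = 0" if "[:p:] \<in> m" for p
    using that by blast
  have diff: "x - y \<in> m" if "x \<in> m" "y \<in> m" for x y
    using add[OF that(1) mult[OF that(2), of "-1"]] by simp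
  have "\<exists>f. f \<in> m \<and> f \<noteq> 0"
  proof (rule ccontr)
    assume *: "\<not> (\<exists>f. f \<in> m \<and> f \<noteq> 0)"
    \<comment> \<open>If the ideal were zero, t would be invertible, which setting t = 0
      refutes.\<close>
    then have "[:0, 1:] \<notin> m"
      by auto
    then obtain y where "[:0, 1:] * y - 1 \<in> m"
      using inv by blast
    with * have "[:0, 1:] * y - 1 = 0"
      by blast
    then have "poly ([:0, 1:] * y - 1) 0 = 0"
      by simp
    then show False
      by simp
  qed
  then obtain f where f: "f \<in> m" "f \<noteq> 0" and least: "\<And>g. g \<in> m \<Longrightarrow> g \<noteq> 0 \<Longrightarrow> degree f \<le> degree g"
    using exists_least_iff[of "\<lambda>n. \<exists>f. f \<in> m \<and> f \<noteq> 0 \<and> degree f = n"] by (metis not_le)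
  define a where "a = lead_coeff f"
  have "a \<noteq> 0"
    using f by (simp add: a_def)
  have deg: "degree f > 0"
  proof (rule ccontr)
    assume "\<not> degree f > 0"
    then obtain c where "f = [:c:]"
      by (metis degree_eq_zeroE gr0I)
    then show False
      using f none[of c] by auto
  qed
  \<comment> \<open>Here \<open>[:0, 1:]\<close> is s. The summand 1 makes \<open>p\<close> coprime
    to every power of \<open>a\<close>, and the factor s makes its degree positive even for constant
    \<open>a\<close>.\<close>
  define p where "p = 1 + [:0, 1:] * a"
  have "degree ([:0, 1:] * a) = Suc (degree a)"
    using \<open>a \<noteq> 0\<close> by (simp add: degree_mult_eq)
  then have degp: "degree p = Suc (degree a)"
    unfolding p_def by (subst degree_add_eq_right) simp_all
  then have "p \<noteq> 0"
    by auto
  then have "[:p:] \<notin> m"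
    using none by blast
  then obtain g where g: "[:p:] * g - 1 \<in> m"
    using inv by blast
  obtain q r where qr: "pseudo_divmod g f = (q, r)"
    by fastforce
  define N where "N = Suc (degree g) - degree f"
  have eq: "smult (a ^ N) g = f * q + r"
    using pseudo_divmod(1)[OF f(2) qr] by (simp add: a_def N_def)
  have degr: "degree r < degree f"
    using pseudo_divmod(2)[OF f(2) qr] deg by auto
  \<comment> \<open>Pseudo-division turns the inverse \<open>g\<close> of \<open>p\<close> into its
    remainder \<open>r\<close>: the element p r - a^N lies in the ideal and has smaller degree in t
    than \<open>f\<close>, so it is zero. Its constant coefficient in t gives the
    divisibility.\<close>
  have "smult (a ^ N) ([:p:] * g - 1) - [:p:] * q * f \<in> m"
    by (intro diff mult[OF f(1)]) (use mult[OF g, of "[:a ^ N:]"] in simp)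
  also have "smult (a ^ N) ([:p:] * g - 1) - [:p:] * q * f = smult p (smult (a ^ N) g) - [:a ^ N:] - smult p (f * q)"
    by (simp add: smult_diff_right mult.commute)
  also have "\<dots> = smult p r - [:a ^ N:]"
    by (simp add: eq smult_add_right)
  finally have in_m: "smult p r - [:a ^ N:] \<in> m" .
  have "degree (smult p r - [:a ^ N:]) < degree f"
    using degr deg degree_smult_le[of p r]
    by (intro degree_diff_less) auto
  then have "smult p r - [:a ^ N:] = 0"
    using least[OF in_m] by (meson not_le)
  then have "coeff (smult p r - [:a ^ N:]) 0 = 0"
    by simp
  then have dvd: "p dvd a ^ N"
    by (metis coeff_diff coeff_pCons_0 coeff_smult dvd_triv_left eq_iff_diff_eq_0)
  have "\<exists>u v. u * p + v * a ^ n = 1" for n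
  proof (induction n)
    case 0
    show ?case
      by (intro exI[of _ 0] exI[of _ 1]) simp
  next
    case (Suc n)
    then obtain u v where uv: "u * p + v * a ^ n = 1"
      by blast
    have "(u + v * a ^ n) * p + (- v * [:0, 1:]) * a ^ Suc n
      = u * p + v * a ^ n * (p - [:0, 1:] * a)"
      by (simp add: algebra_simps)
    also have "\<dots> = 1"
      using uv by (simp add: p_def)
    finally show ?case
      by blast
  qed
  then obtain u v where "u * p + v * a ^ N = 1"
    by blast
  with dvd have "p dvd 1"
    by (metis dvd_add dvd_mult dvd_refl)
  with degp show False
    by (auto simp: is_unit_poly_iff)
qed


section \<open>Krull dimension of \<open>K[s][t]\<close>\<close>

text \<open>The relation is among a family, not a set: if two indices carry the same vector, the
  image may well be independent, and the difference of these two members is the relation.\<close>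

lemma (in vector_space) exists_linear_relation:
  assumes "finite T" "finite B" "card B < card T" "v ` T \<subseteq> span B"
  shows "\<exists>c. (\<exists>t\<in>T. c t \<noteq> 0) \<and> (\<Sum>t\<in>T. c t *s v t) = 0"
proof (cases "inj_on v T")
  case True
  have "dependent (v ` T)"
    using independent_span_bound[OF assms(2) _ assms(4)] card_image[OF True] assms(3) by fastforce
  then obtain u where u: "\<exists>x\<in>v ` T. u x \<noteq> 0" "(\<Sum>x\<in>v ` T. u x *s x) = 0"
    using dependent_finite[of "v ` T"] assms(1) by auto
  from u(2) have "(\<Sum>t\<in>T. (u \<circ> v) t *s v t) = 0"
    by (simp add: sum.reindex[OF True])
  with u(1) show ?thesis
    by (intro exI[of _ "u \<circ> v"]) auto
next
  case False
  then obtain x y where xy: "x \<in> T" "y \<in> T" "x \<noteq> y" "v x = v y"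
    by (auto simp: inj_on_def)
  define c :: "'c \<Rightarrow> 'a" where "c t = (if t = x then 1 else if t = y then -1 else 0)" for t
  have "(\<Sum>t\<in>T. c t *s v t) = (\<Sum>t\<in>{x, y}. c t *s v t)"
    using assms(1) xy by (intro sum.mono_neutral_right) (auto simp: c_def)
  also have "\<dots> = 0"
    using xy by (simp add: c_def)
  finally show ?thesis
    using xy by (intro exI[of _ c]) (auto simp: c_def)
qed

lemma vector_space_poly_poly: "vector_space (\<lambda>(c::'k::field) (f::'k poly poly). smult [:c:] f)"
  by unfold_locales (simp_all add: smult_add_right one_pCons[symmetric] mult.commute flip: smult_add_left)

text \<open>Both partial degrees are bounded, rather than the total degree, so that the monomials
  involved form a square that is easy to count.\<close>

definition bidegree_le :: "nat \<Rightarrow> 'a::comm_ring_1 poly poly set" where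
  "bidegree_le d = {f. degree f \<le> d \<and> (\<forall>j. degree (coeff f j) \<le> d)}"

lemma bidegree_le_mult:
  assumes "f \<in> bidegree_le d" "g \<in> bidegree_le e"
  shows "f * g \<in> bidegree_le (d + e)"
proof -
  have "degree (coeff f i * coeff g j) \<le> d + e" for i j
    using assms degree_mult_le[of "coeff f i" "coeff g j"]
    by (force simp: bidegree_le_def intro: order_trans add_mono)
  then have "degree (coeff (f * g) j) \<le> d + e" for j
    unfolding coeff_mult by (intro degree_sum_le) auto
  moreover have "degree (f * g) \<le> d + e"
    using assms degree_mult_le[of f g] by (force simp: bidegree_le_def)
  ultimately show ?thesis
    by (simp add: bidegree_le_def)
qed

lemma bidegree_le_mono: "d \<le> e \<Longrightarrow> bidegree_le d \<subseteq> bidegree_le e"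
  by (auto simp: bidegree_le_def intro: order_trans)

lemma bidegree_le_power: "f \<in> bidegree_le d \<Longrightarrow> f ^ n \<in> bidegree_le (n * d)"
proof (induction n)
  case 0
  show ?case
    by (auto simp: bidegree_le_def one_pCons coeff_pCons split: nat.splits)
next
  case (Suc n)
  then show ?case
    using bidegree_le_mult[of f d "f ^ n" "n * d"] by simp
qed

lemma exists_bidegree_le: "\<exists>d. f \<in> bidegree_le d"
proof -
  define d where "d = degree f + (\<Sum>j\<le>degree f. degree (coeff f j))"
  have "degree (coeff f j) \<le> d" for j
  proof (cases "j \<le> degree f")
    case True
    then have "degree (coeff f j) \<le> (\<Sum>j\<le>degree f. degree (coeff f j))"
      by (intro member_le_sum) auto
    then show ?thesis
      by (simp add: d_def)
  qed (simp add: coeff_eq_0)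
  then show ?thesis
    by (intro exI[of _ d]) (simp add: bidegree_le_def d_def)
qed

text \<open>A dimension count: the exponents up to \<open>N\<close> give (N + 1)^3 products, all in
  a space of dimension at most (3 N D + 1)^2, where \<open>D\<close> bounds the bidegrees of the
  three elements. The cubic count wins for large \<open>N\<close>.\<close>

lemma exists_algebraic_relation:
  fixes f g h :: "'k::field poly poly"
  shows "\<exists>c N. (\<exists>i\<le>N. \<exists>j\<le>N. \<exists>l\<le>N. c i j l \<noteq> 0) \<and>
    (\<Sum>i\<le>N. \<Sum>j\<le>N. \<Sum>l\<le>N. [:[:c i j l:]:] * h ^ l * g ^ j * f ^ i) = 0"
proof -
  obtain d1 d2 d3 where d: "f \<in> bidegree_le d1" "g \<in> bidegree_le d2" "h \<in> bidegree_le d3"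
    using exists_bidegree_le by metis
  \<comment> \<open>The successor makes \<open>D\<close> positive, which gives 3 N D + 1 <= 3 D (N +
    1) in the count below.\<close>
  define D where "D = Suc (d1 + d2 + d3)"
  have fgh: "f \<in> bidegree_le D" "g \<in> bidegree_le D" "h \<in> bidegree_le D"
    using d bidegree_le_mono[of d1 D] bidegree_le_mono[of d2 D] bidegree_le_mono[of d3 D]
    by (auto simp: D_def)
  \<comment> \<open>With this choice (3 D (N + 1))^2 equals N (N + 1)^2, just below (N +
    1)^3.\<close>
  define N where "N = 9 * D\<^sup>2"
  define T where "T = {..N} \<times> {..N} \<times> {..N}"
  define B :: "'k poly poly set" where "B = (\<lambda>(i, j). monom (monom 1 i) j) ` ({..3 * N * D} \<times> {..3 * N * D})"
  define v where "v = (\<lambda>(i, j, l). h ^ l * g ^ j * f ^ i)"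
  interpret V: vector_space "\<lambda>(c::'k) (f::'k poly poly). smult [:c:] f"
    by (rule vector_space_poly_poly)
  have "card B \<le> card ({..3 * N * D} \<times> {..3 * N * D})"
    unfolding B_def by (intro card_image_le) simp
  also have "\<dots> = (3 * N * D + 1) * (3 * N * D + 1)"
    by (simp add: card_cartesian_product)
  also have "\<dots> \<le> (3 * D * (N + 1)) * (3 * D * (N + 1))"
    by (intro mult_mono) (auto simp: D_def algebra_simps)
  also have "\<dots> = N * (N + 1) * (N + 1)"
    by (simp add: N_def power2_eq_square algebra_simps)
  also have "\<dots> < (N + 1) * (N + 1) * (N + 1)"
    by (intro mult_strict_right_mono) simp_all
  also have "\<dots> = card T"
    by (simp add: T_def card_cartesian_product)
  finally have card: "card B < card T" .
  have span: "F \<in> V.span B" if "F \<in> bidegree_le (3 * N * D)" for F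
  proof -
    have "F = (\<Sum>j\<le>3 * N * D. monom (coeff F j) j)"
      using that poly_as_sum_of_monoms'[of F "3 * N * D"] by (simp add: bidegree_le_def)
    also have "\<dots> = (\<Sum>j\<le>3 * N * D. \<Sum>i\<le>3 * N * D. smult [:coeff (coeff F j) i:] (monom (monom 1 i) j))"
    proof (intro sum.cong refl)
      fix j
      have "coeff F j = (\<Sum>i\<le>3 * N * D. monom (coeff (coeff F j) i) i)"
        using that poly_as_sum_of_monoms'[of "coeff F j" "3 * N * D"] by (simp add: bidegree_le_def)
      then have "monom (coeff F j) j = monom (\<Sum>i\<le>3 * N * D. monom (coeff (coeff F j) i) i) j"
        by simp
      also have "\<dots> = (\<Sum>i\<le>3 * N * D. smult [:coeff (coeff F j) i:] (monom (monom 1 i) j))"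
        by (simp add: monom_sum smult_monom)
      finally show "monom (coeff F j) j = (\<Sum>i\<le>3 * N * D. smult [:coeff (coeff F j) i:] (monom (monom 1 i) j))" .
    qed
    also have "\<dots> \<in> V.span B"
      by (intro V.span_sum V.span_scale V.span_base) (auto simp: B_def)
    finally show ?thesis .
  qed
  have "v ` T \<subseteq> V.span B"
  proof (clarsimp simp: T_def v_def)
    fix i j l assume ijl: "i \<le> N" "j \<le> N" "l \<le> N"
    have "h ^ l * g ^ j * f ^ i \<in> bidegree_le (l * D + j * D + i * D)"
      by (intro bidegree_le_mult bidegree_le_power fgh)
    moreover have "l * D + j * D + i * D \<le> 3 * N * D"
      using ijl mult_le_mono1[of "l + j + i" "3 * N" D] by (simp add: algebra_simps)
    ultimately show "h ^ l * g ^ j * f ^ i \<in> V.span B"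
      using bidegree_le_mono span by blast
  qed
  then obtain c where c: "\<exists>t\<in>T. c t \<noteq> 0" "(\<Sum>t\<in>T. smult [:c t:] (v t)) = 0"
    using V.exists_linear_relation[of T B v] card by (auto simp: T_def B_def)
  have "(\<Sum>i\<le>N. \<Sum>j\<le>N. \<Sum>l\<le>N. [:[:c (i, j, l):]:] * h ^ l * g ^ j * f ^ i) = (\<Sum>t\<in>T. smult [:c t:] (v t))"
    by (simp add: T_def v_def sum.cartesian_product case_prod_unfold mult.assoc)
  with c show ?thesis
    by (intro exI[of _ "\<lambda>i j l. c (i, j, l)"] exI[of _ N]) (auto simp: T_def)
qed

text \<open>Leading zero coefficients are removed by dividing by \<open>a\<close>, which is allowed
  because \<open>P\<close> is prime and omits \<open>a\<close>; the first remaining one is congruent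
  to a multiple of \<open>a\<close> and so lies in \<open>Q\<close>. The predicate \<open>Z\<close>
  marks formally nonzero coefficients: when \<open>b i\<close> is itself a polynomial expression in
  other elements, its value may vanish although its scalar coefficients do not.\<close>

lemma lowest_coeff_in_ideal:
  fixes S P Q :: "'a::comm_ring_1 set"
  assumes prime: "\<And>x y. x * y \<in> P \<Longrightarrow> x \<in> P \<or> y \<in> P"
    and sub: "P \<subseteq> Q"
    and add: "\<And>x y. x \<in> Q \<Longrightarrow> y \<in> Q \<Longrightarrow> x + y \<in> Q"
    and mult: "\<And>x y. x \<in> Q \<Longrightarrow> y * x \<in> Q"
    and a: "a \<in> Q" "a \<notin> P"
    and rel: "(\<Sum>i\<le>(N::nat). b i * a ^ i) \<in> P"
    and nz: "\<exists>i\<le>N. Z i" and zero: "\<And>i. \<not> Z i \<Longrightarrow> b i = 0"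
  shows "\<exists>i\<le>N. Z i \<and> b i \<in> Q"
  using rel nz zero
proof (induction N arbitrary: b Z)
  case 0
  then show ?case
    using sub by auto
next
  case (Suc N)
  have split: "(\<Sum>i\<le>Suc N. b i * a ^ i) = b 0 + a * (\<Sum>i\<le>N. b (Suc i) * a ^ i)"
    by (simp only: sum.atMost_Suc_shift) (simp add: sum_distrib_left algebra_simps)
  show ?case
  proof (cases "Z 0")
    case True
    have "b 0 + a * (\<Sum>i\<le>N. b (Suc i) * a ^ i) \<in> Q"
      using Suc.prems(1) sub unfolding split by blast
    then have "b 0 + a * (\<Sum>i\<le>N. b (Suc i) * a ^ i) + (- (\<Sum>i\<le>N. b (Suc i) * a ^ i)) * a \<in> Q"
      by (rule add[OF _ mult[OF a(1)]])
    then have "b 0 \<in> Q"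
      by (simp add: mult.commute)
    with True show ?thesis
      by blast
  next
    case False
    then have "a * (\<Sum>i\<le>N. b (Suc i) * a ^ i) \<in> P"
      using Suc.prems(1,3) by (simp only: split) simp
    then have "(\<Sum>i\<le>N. b (Suc i) * a ^ i) \<in> P"
      using prime a(2) by blast
    moreover have "\<exists>i\<le>N. Z (Suc i)"
      using Suc.prems(2) False by (metis Suc_le_mono not0_implies_Suc)
    ultimately have "\<exists>i\<le>N. Z (Suc i) \<and> b (Suc i) \<in> Q"
      using Suc.prems(3) by (intro Suc.IH)
    then show ?thesis
      by auto
  qed
qed

text \<open>
  Elements \<open>f\<close>, \<open>g\<close>, \<open>h\<close> of the successive differences are algebraically dependent, and descending to the
  lexicographically lowest coefficient of a relation shows that it lies in the largest of the primes.
\<close>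

lemma no_prime_chain_of_length_3:
  fixes P :: "nat \<Rightarrow> 'k::field poly poly set"
  assumes prime: "\<And>n x y. n \<le> 3 \<Longrightarrow> x * y \<in> P n \<Longrightarrow> x \<in> P n \<or> y \<in> P n"
    and zero: "0 \<in> P 0"
    and add: "\<And>n x y. n \<le> 3 \<Longrightarrow> x \<in> P n \<Longrightarrow> y \<in> P n \<Longrightarrow> x + y \<in> P n"
    and mult: "\<And>n x y. n \<le> 3 \<Longrightarrow> x \<in> P n \<Longrightarrow> y * x \<in> P n"
    and proper: "1 \<notin> P 3"
    and strict: "\<And>n. n < 3 \<Longrightarrow> P n \<subset> P (Suc n)"
  shows False
proof -
  obtain f where f: "f \<in> P 1" "f \<notin> P 0"
    using strict[of 0] by auto
  obtain g where g: "g \<in> P 2" "g \<notin> P 1"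
    using strict[of 1] by (auto simp: numeral_2_eq_2)
  obtain h where h: "h \<in> P 3" "h \<notin> P 2"
    using strict[of 2] by (auto simp: numeral_3_eq_3 numeral_2_eq_2)
  obtain c N where nz: "\<exists>i\<le>N. \<exists>j\<le>N. \<exists>l\<le>N. c i j l \<noteq> 0"
    and rel: "(\<Sum>i\<le>N. \<Sum>j\<le>N. \<Sum>l\<le>N. [:[:c i j l:]:] * h ^ l * g ^ j * f ^ i) = 0"
    using exists_algebraic_relation[of h g f] by (elim exE) (erule conjE, rule that)
  have step: "\<exists>i\<le>N. Z i \<and> b i \<in> P (Suc n)"
    if "n < 3" "a \<in> P (Suc n)" "a \<notin> P n" "(\<Sum>i\<le>N. b i * a ^ i) \<in> P n" "\<exists>i\<le>N. Z i"
      "\<And>i. \<not> Z i \<Longrightarrow> b i = 0" for n a b and Z :: "nat \<Rightarrow> bool"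
  proof (rule lowest_coeff_in_ideal[of "P n" "P (Suc n)", OF _ _ _ _ that(2-6)])
    have n: "n \<le> 3" "Suc n \<le> 3"
      using that(1) by auto
    show "x * y \<in> P n \<Longrightarrow> x \<in> P n \<or> y \<in> P n" for x y
      by (rule prime[OF n(1)])
    show "x \<in> P (Suc n) \<Longrightarrow> y \<in> P (Suc n) \<Longrightarrow> x + y \<in> P (Suc n)" for x y
      by (rule add[OF n(2)])
    show "x \<in> P (Suc n) \<Longrightarrow> y * x \<in> P (Suc n)" for x y
      by (rule mult[OF n(2)])
    show "P n \<subseteq> P (Suc n)"
      using strict[OF that(1)] by blast
  qed
  \<comment> \<open>Three rounds remove f, g and h in this order. Each moves the relation one prime
    up and fixes one exponent; a nonzero scalar in \<open>P 3\<close> remains.\<close>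
  have "\<exists>i\<le>N. (\<exists>j\<le>N. \<exists>l\<le>N. c i j l \<noteq> 0) \<and> (\<Sum>j\<le>N. \<Sum>l\<le>N. [:[:c i j l:]:] * h ^ l * g ^ j) \<in> P (Suc 0)"
  proof (rule step)
    show "(\<Sum>i\<le>N. (\<Sum>j\<le>N. \<Sum>l\<le>N. [:[:c i j l:]:] * h ^ l * g ^ j) * f ^ i) \<in> P 0"
      using rel zero by (simp only: sum_distrib_right)
  qed (use f nz in simp_all)
  then obtain i where i: "\<exists>j\<le>N. \<exists>l\<le>N. c i j l \<noteq> 0"
    "(\<Sum>j\<le>N. (\<Sum>l\<le>N. [:[:c i j l:]:] * h ^ l) * g ^ j) \<in> P (Suc 0)"
    by (auto simp only: sum_distrib_right)
  have "\<exists>j\<le>N. (\<exists>l\<le>N. c i j l \<noteq> 0) \<and> (\<Sum>l\<le>N. [:[:c i j l:]:] * h ^ l) \<in> P (Suc (Suc 0))"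
    by (rule step[OF _ _ _ i(2)]) (use g i(1) in \<open>simp_all add: numeral_2_eq_2\<close>)
  then obtain j where j: "\<exists>l\<le>N. c i j l \<noteq> 0" "(\<Sum>l\<le>N. [:[:c i j l:]:] * h ^ l) \<in> P 2"
    by (auto simp only: numeral_2_eq_2)
  have "\<exists>l\<le>N. c i j l \<noteq> 0 \<and> [:[:c i j l:]:] \<in> P (Suc 2)"
    by (rule step[OF _ _ _ j(2)]) (use h j(1) in \<open>simp_all add: numeral_3_eq_3 numeral_2_eq_2\<close>)
  then obtain l where l: "c i j l \<noteq> 0" "[:[:c i j l:]:] \<in> P 3"
    by (auto simp: numeral_3_eq_3 numeral_2_eq_2)
  have "[:[:inverse (c i j l):]:] * [:[:c i j l:]:] \<in> P 3"
    using l(2) by (rule mult[OF order_refl])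
  with l(1) proper show False
    by (simp add: one_pCons)
qed

section \<open>Hilbert's basis theorem\<close>

text \<open>Ideals of a ring that is a whole type. This version serves only K and the polynomial
  rings built on it; ideals of \<open>R\<close> and of the quotient stay in the carrier-based
  setting.\<close>

definition ideal_of_type :: "'a::comm_ring_1 set \<Rightarrow> bool" where
  "ideal_of_type J \<longleftrightarrow> 0 \<in> J \<and> (\<forall>x\<in>J. \<forall>y\<in>J. x + y \<in> J) \<and> (\<forall>x\<in>J. \<forall>y. y * x \<in> J)"

lemma ideal_of_typeD:
  assumes "ideal_of_type J"
  shows "0 \<in> J" "x \<in> J \<Longrightarrow> y \<in> J \<Longrightarrow> x + y \<in> J" "x \<in> J \<Longrightarrow> y * x \<in> J"
    "x \<in> J \<Longrightarrow> y \<in> J \<Longrightarrow> x - y \<in> J" "(\<And>a. a \<in> A \<Longrightarrow> f a \<in> J) \<Longrightarrow> sum f A \<in> J"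
proof -
  note J = assms[unfolded ideal_of_type_def]
  show *: "0 \<in> J" "x \<in> J \<Longrightarrow> y \<in> J \<Longrightarrow> x + y \<in> J" "x \<in> J \<Longrightarrow> y * x \<in> J" for x y
    using J by auto
  show "x - y \<in> J" if "x \<in> J" "y \<in> J"
    using *(2)[OF that(1) *(3)[OF that(2), of "-1"]] by simp
  show "sum f A \<in> J" if "\<And>a. a \<in> A \<Longrightarrow> f a \<in> J"
    using that by (induction A rule: infinite_finite_induct) (simp_all add: *)
qed

definition noetherian_type :: "'a::comm_ring_1 itself \<Rightarrow> bool" where
  "noetherian_type _ \<longleftrightarrow> (\<forall>J::'a set. ideal_of_type J \<longrightarrow>
     (\<exists>B\<subseteq>J. finite B \<and> (\<forall>x\<in>J. \<exists>c. x = (\<Sum>b\<in>B. c b * b))))"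

lemma noetherian_type_field: "noetherian_type TYPE('k::field)"
  unfolding noetherian_type_def
proof (intro allI impI)
  fix J :: "'k set" assume J: "ideal_of_type J"
  show "\<exists>B\<subseteq>J. finite B \<and> (\<forall>x\<in>J. \<exists>c. x = (\<Sum>b\<in>B. c b * b))"
  proof (cases "J \<subseteq> {0}")
    case True
    then show ?thesis
      by (intro exI[of _ "{}"]) auto
  next
    case False
    then obtain a where a: "a \<in> J" "a \<noteq> 0"
      by auto
    then have "x = (\<Sum>b\<in>{a}. (x / a) * b)" for x
      by simp
    with a show ?thesis
      by (intro exI[of _ "{a}"]) (auto intro!: exI[of _ "\<lambda>_. _ / a"])
  qed
qed

text \<open>The ideals \<open>L d\<close> of coefficients in degree d increase with d, and their
  union is finitely generated, hence attained at some \<open>D\<close>. Lifts of generators of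
  \<open>L d\<close> for d < D and of the union suffice: the top coefficient of any element of
  \<open>J\<close> can be cancelled by them.\<close>

lemma noetherian_type_poly:
  assumes "noetherian_type TYPE('a::comm_ring_1)"
  shows "noetherian_type TYPE('a poly)"
  unfolding noetherian_type_def
proof (intro allI impI)
  fix J :: "'a poly set" assume J: "ideal_of_type J"
  note JD = ideal_of_typeD[OF J]
  \<comment> \<open>The bound on the degree, instead of equality, makes \<open>L d\<close> contain 0
    and be closed under addition.\<close>
  define L where "L d = {coeff f d | f. f \<in> J \<and> degree f \<le> d}" for d
  have L: "ideal_of_type (L d)" for d
    unfolding ideal_of_type_def
  proof (intro conjI ballI allI)
    show "0 \<in> L d"
      using JD(1) by (auto simp: L_def intro!: exI[of _ 0])
    fix x assume "x \<in> L d"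
    then obtain f where f: "f \<in> J" "degree f \<le> d" "x = coeff f d"
      by (auto simp: L_def)
    show "y * x \<in> L d" for y
      using f JD(3)[of f "[:y:]"] degree_smult_le[of y f]
      by (auto simp: L_def intro!: exI[of _ "smult y f"])
    fix y assume "y \<in> L d"
    then obtain g where g: "g \<in> J" "degree g \<le> d" "y = coeff g d"
      by (auto simp: L_def)
    show "x + y \<in> L d"
      using f g JD(2)[of f g] by (auto simp: L_def intro!: exI[of _ "f + g"] degree_add_le)
  qed
  have L_Suc: "L d \<subseteq> L (Suc d)" for d
  proof
    fix x assume "x \<in> L d"
    then obtain f where f: "f \<in> J" "degree f \<le> d" "x = coeff f d"
      by (auto simp: L_def)
    then show "x \<in> L (Suc d)"
      using JD(3)[of f "[:0, 1:]"] degree_pCons_le[of 0 f]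
      by (auto simp: L_def intro!: exI[of _ "pCons 0 f"])
  qed
  then have L_mono: "L d \<subseteq> L e" if "d \<le> e" for d e
    using that by (rule lift_Suc_mono_le)
  have "ideal_of_type (\<Union>d. L d)"
    unfolding ideal_of_type_def
  proof (intro conjI ballI allI)
    show "0 \<in> (\<Union>d. L d)"
      using ideal_of_typeD(1)[OF L] by blast
    fix x assume "x \<in> (\<Union>d. L d)"
    then obtain d where d: "x \<in> L d"
      by blast
    then show "y * x \<in> (\<Union>d. L d)" for y
      using ideal_of_typeD(3)[OF L] by blast
    fix y assume "y \<in> (\<Union>d. L d)"
    then obtain e where e: "y \<in> L e"
      by blast
    have "x + y \<in> L (max d e)"
      using d e L_mono[of d "max d e"] L_mono[of e "max d e"] by (intro ideal_of_typeD(2)[OF L]) auto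
    then show "x + y \<in> (\<Union>d. L d)"
      by blast
  qed
  then obtain B where B: "B \<subseteq> (\<Union>d. L d)" "finite B" "\<And>x. x \<in> (\<Union>d. L d) \<Longrightarrow> \<exists>c. x = (\<Sum>b\<in>B. c b * b)"
    using assms unfolding noetherian_type_def by meson
  from B(1) obtain e where e: "\<And>b. b \<in> B \<Longrightarrow> b \<in> L (e b)"
    by (metis UN_E subsetD)
  define D where "D = (\<Sum>b\<in>B. e b)"
  have "e b \<le> D" if "b \<in> B" for b
    unfolding D_def using that B(2) by (intro member_le_sum) auto
  then have BD: "B \<subseteq> L D"
    using e L_mono by blast
  have "\<exists>C\<subseteq>L d. finite C \<and> (\<forall>x\<in>L d. \<exists>c. x = (\<Sum>b\<in>C. c b * b))" for d
    using assms L unfolding noetherian_type_def by blast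
  then obtain C where C: "\<And>d. C d \<subseteq> L d" "\<And>d. finite (C d)"
    "\<And>d x. x \<in> L d \<Longrightarrow> \<exists>c. x = (\<Sum>b\<in>C d. c b * b)"
    by metis
  define G where "G d = (if d < D then C d else B)" for d
  have fin_G: "finite (G d)" for d
    by (simp add: G_def B(2) C(2))
  have ex_lift: "\<exists>f. f \<in> J \<and> degree f \<le> min d D \<and> coeff f (min d D) = b" if "b \<in> G d" for d b
  proof -
    have "b \<in> L (min d D)"
      using that C(1)[of d] BD by (auto simp: G_def min_def split: if_splits)
    then show ?thesis
      by (auto simp: L_def)
  qed
  define lift where "lift d b = (SOME f. f \<in> J \<and> degree f \<le> min d D \<and> coeff f (min d D) = b)" for d b
  have lift: "lift d b \<in> J" "degree (lift d b) \<le> min d D" "coeff (lift d b) (min d D) = b"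
    if "b \<in> G d" for d b
    using someI_ex[OF ex_lift[OF that]] by (simp_all add: lift_def)
  have gen: "\<exists>c. x = (\<Sum>b\<in>G d. c b * b)" if "x \<in> L d" for d x
    using that B(3) C(3) by (auto simp: G_def)
  define F where "F = (\<Union>d\<le>D. lift d ` G d)"
  \<comment> \<open>From \<open>D\<close> on, the lifts chosen in degree \<open>D\<close> are
    reused, so only finitely many polynomials occur for all d together.\<close>
  define lift' where "lift' d b = lift (min d D) b" for d b
  have GG: "G (min d D) = G d" for d
    by (auto simp: G_def min_def)
  have lift': "lift' d b \<in> F" "lift' d b \<in> J" "degree (lift' d b) \<le> min d D" "coeff (lift' d b) (min d D) = b"
    if "b \<in> G d" for d b
    using lift[of b "min d D"] that by (auto simp: lift'_def F_def GG intro!: bexI[of _ "min d D"])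
  have "finite F"
    by (simp add: F_def fin_G)
  have "F \<subseteq> J"
    using lift(1) by (auto simp: F_def)
  define S where "S = {f. \<exists>c. f = (\<Sum>b\<in>F. c b * b)}"
  have S: "ideal_of_type S"
    unfolding ideal_of_type_def
  proof (intro conjI ballI allI)
    show "0 \<in> S"
      unfolding S_def by (intro CollectI exI[of _ "\<lambda>_. 0"]) simp
    fix f assume "f \<in> S"
    then obtain c where c: "f = (\<Sum>b\<in>F. c b * b)"
      by (auto simp: S_def)
    show "y * f \<in> S" for y
      unfolding S_def c by (intro CollectI exI[of _ "\<lambda>b. y * c b"]) (simp add: sum_distrib_left algebra_simps)
    fix g assume "g \<in> S"
    then obtain c' where c': "g = (\<Sum>b\<in>F. c' b * b)"
      by (auto simp: S_def)
    show "f + g \<in> S"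
      unfolding S_def c c' by (intro CollectI exI[of _ "\<lambda>b. c b + c' b"]) (simp add: sum.distrib algebra_simps)
  qed
  have F_S: "f \<in> S" if "f \<in> F" for f
    unfolding S_def using that \<open>finite F\<close>
    by (auto intro!: exI[of _ "\<lambda>b. if b = f then 1 else 0"] simp: if_distrib[of "\<lambda>x. x * _"] sum.delta cong: if_cong)
  have "f \<in> S" if "f \<in> J" "\<And>i. i \<ge> n \<Longrightarrow> coeff f i = 0" for f n
    using that
  proof (induction n arbitrary: f)
    case 0
    then have "f = 0"
      by (simp add: poly_eq_iff)
    then show ?case
      using ideal_of_typeD(1)[OF S] by simp
  next
    case (Suc n)
    then have "degree f \<le> n"
      by (intro degree_le) auto
    then have "coeff f n \<in> L n"
      using Suc.prems(1) by (auto simp: L_def)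
    then obtain c where c: "coeff f n = (\<Sum>b\<in>G n. c b * b)"
      using gen by blast
    \<comment> \<open>The monomial shifts a lift from degree \<open>min n D\<close> to degree n, so
      that \<open>g\<close> has the same coefficient at n as \<open>f\<close> and none
      above.\<close>
    define g where "g = (\<Sum>b\<in>G n. monom (c b) (n - min n D) * lift' n b)"
    have "g \<in> S"
      unfolding g_def
      by (intro ideal_of_typeD(5)[OF S] ideal_of_typeD(3)[OF S] F_S lift')
    have "g \<in> J"
      unfolding g_def by (intro JD(5) JD(3) lift')
    have "f - g \<in> S"
    proof (rule Suc.IH)
      show "f - g \<in> J"
        using Suc.prems(1) \<open>g \<in> J\<close> by (rule JD(4))
      fix i assume "i \<ge> n"
      show "coeff (f - g) i = 0"
      proof (cases "i = n")
        case True
        have "coeff g n = (\<Sum>b\<in>G n. c b * b)"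
          unfolding g_def coeff_sum using lift'(4)
          by (intro sum.cong) (auto simp: coeff_monom_mult)
        then show ?thesis
          using True c by simp
      next
        case False
        have "coeff g i = (\<Sum>b\<in>G n. 0)"
          unfolding g_def coeff_sum
        proof (intro sum.cong refl)
          fix b assume b: "b \<in> G n"
          have "coeff (lift' n b) (i - (n - min n D)) = 0"
            using lift'(3)[OF b] False \<open>i \<ge> n\<close> by (intro coeff_eq_0) auto
          then show "coeff (monom (c b) (n - min n D) * lift' n b) i = 0"
            by (simp add: coeff_monom_mult)
        qed
        moreover have "coeff f i = 0"
          using False \<open>i \<ge> n\<close> Suc.prems(2) by simp
        ultimately show ?thesis
          by simp
      qed
    qed
    from ideal_of_typeD(2)[OF S this \<open>g \<in> S\<close>] show ?case
      by simp
  qed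
  then have "f \<in> S" if "f \<in> J" for f
    using that by (metis Suc_le_eq coeff_eq_0)
  then show "\<exists>B\<subseteq>J. finite B \<and> (\<forall>x\<in>J. \<exists>c. x = (\<Sum>b\<in>B. c b * b))"
    using \<open>finite F\<close> \<open>F \<subseteq> J\<close> by (intro exI[of _ F]) (auto simp: S_def)
qed

section \<open>The polynomial ring and monomial ideals\<close>

abbreviation "keys \<equiv> Poly_Mapping.keys"
abbreviation "lookup \<equiv> Poly_Mapping.lookup"
abbreviation "single \<equiv> Poly_Mapping.single"

lemma keys_add_nat: "keys (m + n) = keys m \<union> keys (n :: 'v \<Rightarrow>\<^sub>0 nat)"
  by (auto simp: in_keys_iff lookup_add)

lemma sum_single_lookup: "(\<Sum>m\<in>keys f. single m (lookup f m)) = f"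
proof (rule poly_mapping_eqI)
  fix k
  have "lookup (\<Sum>m\<in>keys f. single m (lookup f m)) k = (\<Sum>m\<in>keys f. if k = m then lookup f m else 0)"
    by (simp add: lookup_sum lookup_single when_def eq_commute)
  then show "lookup (\<Sum>m\<in>keys f. single m (lookup f m)) k = lookup f k"
    by (simp add: sum.delta in_keys_iff)
qed

lemma poly_ring_simps [simp]:
  "mult (poly_ring V) = (*)" "one (poly_ring V) = 1" "zero (poly_ring V) = 0" "add (poly_ring V) = (+)"
  by (simp_all add: poly_ring_def)

lemma in_poly_ring_iff: "f \<in> carrier (poly_ring V) \<longleftrightarrow> (\<forall>m\<in>keys f. keys m \<subseteq> V)"
  by (simp add: poly_ring_def)

lemma poly_ring_closed:
  assumes "f \<in> carrier (poly_ring V)" "g \<in> carrier (poly_ring V)"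
  shows "f + g \<in> carrier (poly_ring V)" "f * g \<in> carrier (poly_ring V)" "- f \<in> carrier (poly_ring V)"
    "f - g \<in> carrier (poly_ring V)"
proof -
  have add: "f + g \<in> carrier (poly_ring V)" if "g \<in> carrier (poly_ring V)" for g
    using assms(1) that keys_add[of f g] by (auto simp: in_poly_ring_iff)
  show "f + g \<in> carrier (poly_ring V)"
    by (rule add[OF assms(2)])
  show "f * g \<in> carrier (poly_ring V)"
    unfolding in_poly_ring_iff
  proof
    fix m assume "m \<in> keys (f * g)"
    then obtain a b where "m = a + b" "a \<in> keys f" "b \<in> keys g"
      using keys_mult[of f g] by blast
    then show "keys m \<subseteq> V"
      using assms by (simp add: in_poly_ring_iff keys_add_nat)
  qed
  have uminus: "- g \<in> carrier (poly_ring V)" if "g \<in> carrier (poly_ring V)" for g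
  proof -
    have "keys (- g) = keys g"
      by (simp add: set_eq_iff in_keys_iff)
    then show ?thesis
      using that by (simp add: in_poly_ring_iff)
  qed
  show "- f \<in> carrier (poly_ring V)"
    by (rule uminus[OF assms(1)])
  show "f - g \<in> carrier (poly_ring V)"
    using add[OF uminus[OF assms(2)]] by simp
qed

lemma zero_in_poly_ring [simp]: "0 \<in> carrier (poly_ring V)"
  by (simp add: in_poly_ring_iff)

lemma one_in_poly_ring [simp]: "1 \<in> carrier (poly_ring V)"
  by (simp add: in_poly_ring_iff)

lemma single_in_poly_ring: "keys m \<subseteq> V \<Longrightarrow> single m c \<in> carrier (poly_ring V)"
  by (simp add: in_poly_ring_iff)

lemma xvar_in_poly_ring: "v \<in> V \<Longrightarrow> xvar v \<in> carrier (poly_ring V)"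
  unfolding xvar_def by (intro single_in_poly_ring) simp

lemma sum_in_poly_ring:
  "(\<And>a. a \<in> A \<Longrightarrow> f a \<in> carrier (poly_ring V)) \<Longrightarrow> sum f A \<in> carrier (poly_ring V)"
  by (induction A rule: infinite_finite_induct) (simp_all add: poly_ring_closed)

lemma cring_poly_ring: "cring (poly_ring V :: ('v, 'k::field) mpoly ring)"
proof (rule cringI)
  show "abelian_group (poly_ring V :: ('v, 'k) mpoly ring)"
  proof (rule abelian_groupI)
    fix x assume "x \<in> carrier (poly_ring V :: ('v, 'k) mpoly ring)"
    then show "\<exists>y\<in>carrier (poly_ring V). y \<oplus>\<^bsub>poly_ring V\<^esub> x = \<zero>\<^bsub>poly_ring V\<^esub>"
      by (intro bexI[of _ "- x"]) (simp_all add: poly_ring_closed)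
  qed (simp_all add: poly_ring_closed add_ac)
  show "Group.comm_monoid (poly_ring V :: ('v, 'k) mpoly ring)"
    by (rule comm_monoidI) (simp_all add: poly_ring_closed mult_ac)
qed (simp add: algebra_simps)

lemma ideal_poly_ringI:
  fixes I :: "('v, 'k::field) mpoly set"
  assumes "I \<subseteq> carrier (poly_ring V)" "0 \<in> I" "\<And>x y. x \<in> I \<Longrightarrow> y \<in> I \<Longrightarrow> x + y \<in> I"
    "\<And>r x. r \<in> carrier (poly_ring V) \<Longrightarrow> x \<in> I \<Longrightarrow> r * x \<in> I"
  shows "ideal I (poly_ring V)"
proof -
  interpret cring "poly_ring V :: ('v, 'k) mpoly ring"
    by (rule cring_poly_ring)
  show ?thesis
  proof (rule idealI)
    show "subgroup I (add_monoid (poly_ring V))"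
    proof (rule add.subgroupI)
      fix x assume x: "x \<in> I"
      have "- x \<in> I"
        using assms(4)[OF poly_ring_closed(3)[OF one_in_poly_ring one_in_poly_ring] x] by simp
      moreover have "\<ominus>\<^bsub>poly_ring V\<^esub> x = - x"
        using x assms(1) by (intro minus_equality) (auto simp: poly_ring_closed)
      ultimately show "\<ominus>\<^bsub>poly_ring V\<^esub> x \<in> I"
        by simp
    qed (use assms in auto)
    show "ring (poly_ring V :: ('v, 'k) mpoly ring)"
      by (rule ring_axioms)
    fix a x :: "('v, 'k) mpoly" assume "a \<in> I" "x \<in> carrier (poly_ring V)"
    then show "x \<otimes>\<^bsub>poly_ring V\<^esub> a \<in> I" "a \<otimes>\<^bsub>poly_ring V\<^esub> x \<in> I"
      using assms(4)[of x a] by (simp_all add: mult.commute)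
  qed
qed

lemma ideal_poly_ringD:
  assumes "ideal I (poly_ring V)"
  shows "I \<subseteq> carrier (poly_ring V)" "0 \<in> I" "x \<in> I \<Longrightarrow> y \<in> I \<Longrightarrow> x + y \<in> I"
    "r \<in> carrier (poly_ring V) \<Longrightarrow> x \<in> I \<Longrightarrow> r * x \<in> I"
    "x \<in> I \<Longrightarrow> y \<in> I \<Longrightarrow> x - y \<in> I"
    "(\<And>a. a \<in> A \<Longrightarrow> f a \<in> I) \<Longrightarrow> sum f A \<in> I"
proof -
  interpret ideal I "poly_ring V"
    by (rule assms)
  show "I \<subseteq> carrier (poly_ring V)"
    by (rule a_subset)
  show 0: "0 \<in> I"
    using additive_subgroup.zero_closed[OF is_additive_subgroup] by simp
  show add: "x + y \<in> I" if "x \<in> I" "y \<in> I" for x y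
    using additive_subgroup.a_closed[OF is_additive_subgroup that] by simp
  show mult: "r * x \<in> I" if "r \<in> carrier (poly_ring V)" "x \<in> I" for r x
    using I_l_closed[OF that(2,1)] by simp
  show "x - y \<in> I" if "x \<in> I" "y \<in> I"
    using add[OF that(1) mult[OF poly_ring_closed(3)[OF one_in_poly_ring one_in_poly_ring] that(2)]] by simp
  show "sum f A \<in> I" if "\<And>a. a \<in> A \<Longrightarrow> f a \<in> I"
    using that by (induction A rule: infinite_finite_induct) (simp_all add: 0 add)
qed

text \<open>Exponents add, so \<open>m = x + y\<close> is divisibility of monomials. The right side
  is an ideal containing the generators, and each of its elements is the sum of its terms, all
  multiples of generators.\<close>

lemma genideal_monomials:
  fixes X :: "('v \<Rightarrow>\<^sub>0 nat) set"
  assumes X: "\<And>x. x \<in> X \<Longrightarrow> keys x \<subseteq> V"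
  shows "genideal (poly_ring V) ((\<lambda>x. single x (1::'k::field)) ` X) =
    {f \<in> carrier (poly_ring V). \<forall>m\<in>keys f. \<exists>x\<in>X. \<exists>y. m = x + y}" (is "?G = ?M")
proof
  interpret cring "poly_ring V :: ('v, 'k) mpoly ring"
    by (rule cring_poly_ring)
  have gens: "(\<lambda>x. single x 1) ` X \<subseteq> carrier (poly_ring V)"
    using X by (auto intro: single_in_poly_ring)
  note G = genideal_ideal[OF gens]
  show "?G \<subseteq> ?M"
  proof (rule genideal_minimal)
    show "ideal ?M (poly_ring V)"
    proof (rule ideal_poly_ringI)
      fix f g :: "('v, 'k) mpoly" assume f: "f \<in> ?M" and g: "g \<in> ?M"
      then show "f + g \<in> ?M"
        using keys_add[of f g] by (auto simp: poly_ring_closed)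
    next
      fix r f :: "('v, 'k) mpoly" assume r: "r \<in> carrier (poly_ring V)" and f: "f \<in> ?M"
      have "\<exists>x\<in>X. \<exists>y. m = x + y" if m: "m \<in> keys (r * f)" for m
      proof -
        obtain a b where ab: "m = a + b" "b \<in> keys f"
          using keys_mult[of r f] m by blast
        then obtain x y where xy: "x \<in> X" "b = x + y"
          using f by blast
        then have "m = x + (a + y)"
          using ab by (simp add: add_ac)
        with xy show ?thesis
          by blast
      qed
      then show "r * f \<in> ?M"
        using r f by (simp add: poly_ring_closed)
    qed auto
    show "(\<lambda>x. single x 1) ` X \<subseteq> ?M"
    proof
      fix f :: "('v, 'k) mpoly" assume "f \<in> (\<lambda>x. single x 1) ` X"
      then obtain x where x: "x \<in> X" "f = single x 1"
        by blast
      moreover have "\<exists>x'\<in>X. \<exists>y. x = x' + y"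
        using x(1) by (intro bexI[of _ x] exI[of _ 0]) simp_all
      ultimately show "f \<in> ?M"
        using X by (simp add: single_in_poly_ring)
    qed
  qed
  show "?M \<subseteq> ?G"
  proof
    fix f assume f: "f \<in> ?M"
    have "single m (lookup f m) \<in> ?G" if m: "m \<in> keys f" for m
    proof -
      obtain x y where xy: "x \<in> X" "m = x + y"
        using f m by blast
      have "keys m \<subseteq> V"
        using f m by (simp add: in_poly_ring_iff)
      then have "keys y \<subseteq> V"
        using xy by (simp add: keys_add_nat)
      then have "single y (lookup f m) * single x 1 \<in> ?G"
        using genideal_self[OF gens] xy(1) by (intro ideal_poly_ringD(4)[OF G] single_in_poly_ring) auto
      then show ?thesis
        by (simp add: mult_single xy(2) add.commute)
    qed
    then have "(\<Sum>m\<in>keys f. single m (lookup f m)) \<in> ?G"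
      by (rule ideal_poly_ringD(6)[OF G])
    then show "f \<in> ?G"
      by (simp add: sum_single_lookup)
  qed
qed

section \<open>Restriction to two variables\<close>

text \<open>The vertex \<open>u\<close> goes with the inner variable s and \<open>v\<close> with the
  outer variable t. Swapping them exchanges s and t but does not affect vanishing.\<close>

definition restr_term :: "'v \<Rightarrow> 'v \<Rightarrow> ('v \<Rightarrow>\<^sub>0 nat) \<Rightarrow> 'k::field \<Rightarrow> 'k poly poly" where
  "restr_term u v m c = (if keys m \<subseteq> {u, v} then monom (monom c (lookup m u)) (lookup m v) else 0)"

text \<open>The substitution \<open>x\<^sub>u \<mapsto> s\<close>, \<open>x\<^sub>v \<mapsto> t\<close>, and \<open>x\<^sub>w \<mapsto> 0\<close> for all other \<open>w\<close>.\<close>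

definition restr :: "'v \<Rightarrow> 'v \<Rightarrow> ('v, 'k::field) mpoly \<Rightarrow> 'k poly poly" where
  "restr u v f = (\<Sum>m\<in>keys f. restr_term u v m (lookup f m))"

lemma restr_term_0 [simp]: "restr_term u v m 0 = 0"
  by (simp add: restr_term_def)

lemma restr_single: "restr u v (single m c) = restr_term u v m c"
  by (simp add: restr_def)

lemma two_vars_eqI:
  assumes "keys m \<subseteq> {u, v}" "u \<noteq> v"
  shows "m = single u (lookup m u) + single v (lookup m v)"
proof (rule poly_mapping_eqI)
  fix k
  have "lookup m k = 0" if "k \<noteq> u" "k \<noteq> v"
    using that assms(1) by (auto simp: in_keys_iff)
  then show "lookup m k = lookup (single u (lookup m u) + single v (lookup m v)) k"
    using assms(2) by (auto simp: lookup_add lookup_single when_def)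
qed

text \<open>The substitution discards terms and never merges them, so coefficients of
  \<open>f\<close> can be read off its restrictions. The vanishing criterion, the compatibility of
  restrictions and the glueing all rest on this.\<close>

lemma coeff_restr:
  assumes "u \<noteq> v"
  shows "coeff (coeff (restr u v f) j) i = lookup f (single u i + single v j)"
proof -
  let ?k = "single u i + single v j"
  have *: "keys m \<subseteq> {u, v} \<and> lookup m v = j \<and> lookup m u = i \<longleftrightarrow> m = ?k" for m
    using two_vars_eqI[of m u v] assms
    by (auto simp: lookup_add lookup_single keys_add_nat when_def split: if_splits)
  have "coeff (coeff (restr u v f) j) i = (\<Sum>m\<in>keys f. if keys m \<subseteq> {u, v} \<and> lookup m v = j \<and> lookup m u = i then lookup f m else 0)"
    unfolding restr_def coeff_sum restr_term_def by (intro sum.cong) auto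
  also have "\<dots> = (\<Sum>m\<in>keys f. if m = ?k then lookup f m else 0)"
    unfolding * ..
  also have "\<dots> = lookup f ?k"
    by (simp add: in_keys_iff)
  finally show ?thesis .
qed

lemma restr_eq_0_iff:
  assumes "u \<noteq> v"
  shows "restr u v f = 0 \<longleftrightarrow> (\<forall>m\<in>keys f. \<not> keys m \<subseteq> {u, v})"
proof
  assume 0: "restr u v f = 0"
  show "\<forall>m\<in>keys f. \<not> keys m \<subseteq> {u, v}"
  proof (intro ballI notI)
    fix m assume m: "m \<in> keys f" "keys m \<subseteq> {u, v}"
    have "lookup f (single u (lookup m u) + single v (lookup m v)) = 0"
      using coeff_restr[OF assms, of f "lookup m v" "lookup m u"] 0 by simp
    then show False
      using m two_vars_eqI[OF m(2) assms] by (simp add: in_keys_iff)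
  qed
qed (simp add: restr_def restr_term_def)

lemma restr_term_mult:
  assumes "u \<noteq> v"
  shows "restr_term u v (m + n) (c * d) = restr_term u v m c * restr_term u v n d"
  by (auto simp: restr_term_def keys_add_nat lookup_add mult_monom)

lemma ring_morph_restr:
  assumes "u \<noteq> v"
  shows "ring_morph (restr u v :: ('v, 'k::field) mpoly \<Rightarrow> _)"
proof -
  have add: "restr u v (f + g) = restr u v f + restr u v g" for f g :: "('v, 'k) mpoly"
    unfolding restr_def
    by (rule setsum_keys_plus_distrib) (simp_all add: restr_term_def add_monom)
  then interpret additive "restr u v :: ('v, 'k) mpoly \<Rightarrow> _"
    by unfold_locales
  have "restr u v (f * g) = restr u v f * restr u v g" for f g :: "('v, 'k) mpoly"
  proof -
    have "f * g = (\<Sum>m\<in>keys f. single m (lookup f m)) * (\<Sum>n\<in>keys g. single n (lookup g n))"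
      by (simp only: sum_single_lookup)
    also have "\<dots> = (\<Sum>m\<in>keys f. \<Sum>n\<in>keys g. single (m + n) (lookup f m * lookup g n))"
      by (simp only: sum_product mult_single)
    finally have "f * g = (\<Sum>m\<in>keys f. \<Sum>n\<in>keys g. single (m + n) (lookup f m * lookup g n))" .
    then have "restr u v (f * g) = (\<Sum>m\<in>keys f. \<Sum>n\<in>keys g. restr_term u v m (lookup f m) * restr_term u v n (lookup g n))"
      by (simp add: sum restr_single restr_term_mult[OF assms])
    also have "\<dots> = restr u v f * restr u v g"
      by (simp add: restr_def sum_product)
    finally show ?thesis .
  qed
  moreover have "restr u v (1 :: ('v, 'k) mpoly) = 1"
    by (simp add: restr_single restr_term_def flip: single_one)
  ultimately show ?thesis
    using add by (simp add: ring_morph_def)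
qed

lemma restr_const: "restr u v (single 0 c) = [:[:c:]:]"
  by (simp add: restr_single restr_term_def monom_0)

lemma restr_xvar:
  assumes "u \<noteq> v"
  shows "restr u v (xvar w) = (if w = u then [:[:0, 1:]:] else if w = v then [:0, 1:] else 0)"
  using assms by (auto simp: xvar_def restr_single restr_term_def lookup_single monom_0 monom_Suc when_def)

lemma ring_morph_const: "ring_morph (single 0 :: 'k::field \<Rightarrow> ('v, 'k) mpoly)"
  by (simp add: ring_morph_def single_add mult_single)

lemma subst_poly_in_poly_ring:
  assumes "\<And>c. h c \<in> carrier (poly_ring V)" "h 0 = 0" "a \<in> carrier (poly_ring V)"
  shows "subst_poly h a p \<in> carrier (poly_ring V)"
  using assms by (induction p) (simp_all add: subst_poly_pCons poly_ring_closed)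

lemma subst2_in_poly_ring:
  assumes "a \<in> carrier (poly_ring V)" "b \<in> carrier (poly_ring V)"
  shows "subst2 (single 0) a b f \<in> carrier (poly_ring V)"
  unfolding subst2_def using assms
  by (intro subst_poly_in_poly_ring single_in_poly_ring) simp_all

text \<open>Any \<open>a\<close>, \<open>b\<close> restricting to s, t give a right inverse of
  \<open>restr u v\<close>. Glueing uses the two variables themselves, and the ring theory uses
  theta1 and theta2, which do not depend on the non-edge.\<close>

lemma restr_subst2:
  assumes "u \<noteq> v" and a: "restr u v a = [:[:0, 1:]:]" and b: "restr u v b = [:0, 1:]"
  shows "restr u v (subst2 (single 0) a b f) = f"
proof -
  note r = ring_morphD[OF ring_morph_restr[OF assms(1)]]
  have "restr u v (subst_poly (single 0) a p) = [:p:]" for p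
    by (induction p) (simp_all add: subst_poly_pCons r a restr_const)
  then show ?thesis
    unfolding subst2_def by (induction f) (simp_all add: subst_poly_pCons r b)
qed

section \<open>Graphs covered by two cliques\<close>

lemma simple_graph_edgeE:
  assumes "simple_graph V E" "e \<in> E"
  obtains u v where "e = {u, v}" "u \<noteq> v" "u \<in> V" "v \<in> V"
  using assms unfolding simple_graph_def complete_edges_def card_2_iff by blast

lemma xvar_mult: "xvar u * xvar v = (single (single u 1 + single v 1) 1 :: ('v, 'k::field) mpoly)"
  by (simp add: xvar_def mult_single)

lemma pair_divides_iff:
  assumes "u \<noteq> v"
  shows "(\<exists>y. m = single u 1 + single v 1 + y) \<longleftrightarrow> {u, v} \<subseteq> keys (m :: 'v \<Rightarrow>\<^sub>0 nat)"
proof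
  assume "\<exists>y. m = single u 1 + single v 1 + y"
  then show "{u, v} \<subseteq> keys m"
    by (auto simp: keys_add_nat)
next
  assume *: "{u, v} \<subseteq> keys m"
  have "m = single u 1 + single v 1 + (m - (single u 1 + single v 1))"
  proof (rule poly_mapping_eqI)
    fix k
    show "lookup m k = lookup (single u 1 + single v 1 + (m - (single u 1 + single v 1))) k"
      using * assms by (auto simp: lookup_add lookup_minus lookup_single when_def in_keys_iff)
  qed
  then show "\<exists>y. m = single u 1 + single v 1 + y"
    by blast
qed

lemma in_edge_ideal_iff:
  assumes "simple_graph V E"
  shows "(f :: ('v, 'k::field) mpoly) \<in> edge_ideal V E \<longleftrightarrow>
    f \<in> carrier (poly_ring V) \<and> (\<forall>m\<in>keys f. \<exists>e\<in>E. e \<subseteq> keys m)"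
proof -
  define X where "X = {single u (1::nat) + single v 1 | u v. {u, v} \<in> E}"
  have "{xvar u * xvar v | u v. {u, v} \<in> E} = (\<lambda>x. single x (1::'k)) ` X"
    by (auto simp: X_def xvar_mult)
  moreover have "keys x \<subseteq> V" if "x \<in> X" for x
    using that assms by (auto simp: X_def keys_add_nat simple_graph_def complete_edges_def split: if_splits)
  moreover have "(\<exists>x\<in>X. \<exists>y. m = x + y) \<longleftrightarrow> (\<exists>e\<in>E. e \<subseteq> keys m)" for m
  proof
    assume "\<exists>x\<in>X. \<exists>y. m = x + y"
    then obtain u v y where uv: "{u, v} \<in> E" "m = single u 1 + single v 1 + y"
      by (auto simp: X_def)
    then show "\<exists>e\<in>E. e \<subseteq> keys m"
      by (intro bexI[of _ "{u, v}"]) (auto simp: keys_add_nat)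
  next
    assume "\<exists>e\<in>E. e \<subseteq> keys m"
    then obtain u v where uv: "{u, v} \<in> E" "u \<noteq> v" "{u, v} \<subseteq> keys m"
      using assms by (metis simple_graph_edgeE)
    then obtain y where "m = single u 1 + single v 1 + y"
      using pair_divides_iff by metis
    with uv(1) show "\<exists>x\<in>X. \<exists>y. m = x + y"
      by (auto simp: X_def)
  qed
  ultimately show ?thesis
    unfolding edge_ideal_def by (simp add: genideal_monomials)
qed

lemma ideal_edge_ideal:
  assumes "simple_graph V E"
  shows "ideal (edge_ideal V E) (poly_ring V)"
  unfolding edge_ideal_def
proof (rule ring.genideal_ideal[OF cring.axioms(1)[OF cring_poly_ring]], clarify)
  fix u v assume "{u, v} \<in> E"
  then have "u \<in> V" "v \<in> V"
    using assms by (auto simp: simple_graph_def complete_edges_def)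
  then show "xvar u * xvar v \<in> carrier (poly_ring V)"
    by (intro poly_ring_closed xvar_in_poly_ring)
qed

text \<open>This says that q(t) is a nonzerodivisor modulo p(s). The leading coefficient of q(t) in
  t is a nonzero scalar, so p divides the leading coefficient of \<open>y\<close>; subtracting that
  term lowers the degree of \<open>y\<close> or leaves 0.\<close>

lemma const_poly_dvd_cancel:
  fixes p :: "'a::field poly" and q :: "'a poly"
  assumes "q \<noteq> 0" "[:p:] * z = map_poly (\<lambda>c. [:c:]) q * y"
  shows "\<exists>w. y = [:p:] * w"
  using assms(2)
proof (induction "degree y" arbitrary: y z rule: less_induct)
  case less
  define qq where "qq = map_poly (\<lambda>c. [:c:]) q"
  have deg_qq: "degree qq = degree q"
    by (simp add: qq_def degree_map_poly)
  have "coeff (qq * y) (degree qq + degree y) = coeff qq (degree qq) * coeff y (degree y)"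
    by (rule coeff_mult_degree_sum)
  also have "coeff qq (degree qq) = [:lead_coeff q:]"
    by (simp add: deg_qq) (simp add: qq_def coeff_map_poly)
  finally have lc: "coeff (qq * y) (degree qq + degree y) = [:lead_coeff q:] * lead_coeff y" .
  have "p * coeff z (degree qq + degree y) = coeff ([:p:] * z) (degree qq + degree y)"
    by simp
  also have "\<dots> = smult (lead_coeff q) (lead_coeff y)"
    unfolding less.prems qq_def[symmetric] lc by simp
  finally have "smult (inverse (lead_coeff q)) (p * coeff z (degree qq + degree y)) = lead_coeff y"
    using assms(1) by simp
  then obtain c where c: "lead_coeff y = p * c"
    by (metis mult_smult_right)
  define y' where "y' = y - [:p:] * monom c (degree y)"
  have eq: "[:p:] * (z - qq * monom c (degree y)) = qq * y'"
    using less.prems by (simp add: y'_def qq_def[symmetric] algebra_simps)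
  have "coeff y' i = 0" if "i \<ge> degree y" for i
    using that c by (cases "i = degree y") (simp_all add: y'_def coeff_eq_0)
  then have "degree y' < degree y \<or> y' = 0"
    by (metis leading_coeff_0_iff not_le)
  then obtain w where "y' = [:p:] * w"
  proof
    assume "degree y' < degree y"
    then show ?thesis
      using less.hyps[of y'] eq that unfolding qq_def by blast
  qed (use that[of 0] in simp)
  then have "y = [:p:] * (w + monom c (degree y))"
    by (simp add: y'_def algebra_simps)
  then show ?case
    by blast
qed

text \<open>The last two assumptions say that the independence complex is connected without isolated
  vertices. Taking u = u' in the first of them also gives each vertex of \<open>V1\<close> a
  non-neighbour.\<close>

locale two_cliques =
  fixes V1 V2 :: "'v set" and E :: "'v set set"
  assumes finite: "finite V1" "finite V2" and disjoint: "V1 \<inter> V2 = {}" and nonempty: "V1 \<noteq> {}"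
    and simple: "simple_graph (V1 \<union> V2) E"
    and cliques: "complete_edges V1 \<subseteq> E" "complete_edges V2 \<subseteq> E"
    and common_nonneighbour: "u \<in> V1 \<Longrightarrow> u' \<in> V1 \<Longrightarrow> \<exists>v\<in>V2. {u, v} \<notin> E \<and> {u', v} \<notin> E"
    and nonneighbour: "v \<in> V2 \<Longrightarrow> \<exists>u\<in>V1. {u, v} \<notin> E"
begin

definition V :: "'v set" where "V = V1 \<union> V2"

definition nonedges :: "('v \<times> 'v) set" where
  "nonedges = {(u, v). u \<in> V1 \<and> v \<in> V2 \<and> {u, v} \<notin> E}"

lemma simple_V: "simple_graph V E"
  using simple by (simp add: V_def)

lemma finite_nonedges: "finite nonedges"
  by (rule finite_subset[of _ "V1 \<times> V2"]) (auto simp: nonedges_def finite)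

lemma nonedgesD:
  assumes "(u, v) \<in> nonedges"
  shows "u \<in> V1" "v \<in> V2" "u \<noteq> v" "{u, v} \<notin> E" "u \<in> V" "v \<in> V"
  using assms disjoint by (auto simp: nonedges_def V_def)

text \<open>An independent set has at most one vertex in each clique, and a missing vertex, or both
  for the empty set, can be supplied by a non-neighbour.\<close>

lemma independent_subset_nonedge:
  assumes W: "W \<subseteq> V" "\<And>e. e \<in> E \<Longrightarrow> \<not> e \<subseteq> W"
  shows "\<exists>(u, v)\<in>nonedges. W \<subseteq> {u, v}"
proof -
  have one1: "x = y" if "x \<in> W \<inter> V1" "y \<in> W \<inter> V1" for x y
  proof (rule ccontr)
    assume "x \<noteq> y"
    then have "{x, y} \<in> complete_edges V1"
      using that by (auto simp: complete_edges_def)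
    then show False
      using W(2)[of "{x, y}"] that cliques(1) by blast
  qed
  have one2: "x = y" if "x \<in> W \<inter> V2" "y \<in> W \<inter> V2" for x y
  proof (rule ccontr)
    assume "x \<noteq> y"
    then have "{x, y} \<in> complete_edges V2"
      using that by (auto simp: complete_edges_def)
    then show False
      using W(2)[of "{x, y}"] that cliques(2) by blast
  qed
  show ?thesis
  proof (cases "W \<inter> V1 = {}")
    case True
    then have W2: "W \<subseteq> V2"
      using W(1) by (auto simp: V_def)
    obtain v where v: "v \<in> V2" "W \<subseteq> {v}"
    proof (cases "W = {}")
      case True
      obtain u where "u \<in> V1"
        using nonempty by blast
      then show thesis
        using common_nonneighbour[of u u] that True by blast
    next
      case False
      then show thesis
        using that one2 W2 by blast
    qed
    then obtain u where "(u, v) \<in> nonedges"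
      using nonneighbour[OF v(1)] by (auto simp: nonedges_def)
    with v(2) show ?thesis
      by blast
  next
    case False
    then obtain u where u: "u \<in> W" "u \<in> V1"
      by blast
    show ?thesis
    proof (cases "W \<inter> V2 = {}")
      case True
      then have "W \<subseteq> {u}"
        using one1 u W(1) by (auto simp: V_def)
      moreover obtain v where "(u, v) \<in> nonedges"
        using common_nonneighbour[OF u(2) u(2)] u(2) by (auto simp: nonedges_def)
      ultimately show ?thesis
        by blast
    next
      case False
      then obtain v where v: "v \<in> W" "v \<in> V2"
        by blast
      have "W \<subseteq> {u, v}"
        using one1 one2 u v W(1) by (auto simp: V_def)
      moreover have "{u, v} \<notin> E"
        using W(2)[of "{u, v}"] u v by blast
      ultimately show ?thesis
        using u v by (auto simp: nonedges_def)
    qed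
  qed
qed

text \<open>A monomial outside the edge ideal has independent support, so some non-edge contains the
  support and the restriction there keeps the monomial. Thus I(G) is the intersection of the
  kernels, and the quotient embeds into a product of copies of K[s, t].\<close>

lemma in_edge_ideal_iff_restr:
  assumes "f \<in> carrier (poly_ring V)"
  shows "(f :: ('v, 'k::field) mpoly) \<in> edge_ideal V E \<longleftrightarrow> (\<forall>(u, v)\<in>nonedges. restr u v f = 0)"
proof
  assume f: "f \<in> edge_ideal V E"
  have *: "\<exists>e\<in>E. e \<subseteq> keys m" if "m \<in> keys f" for m
    using f that by (simp add: in_edge_ideal_iff[OF simple_V])
  have "restr u v f = 0" if "(u, v) \<in> nonedges" for u v
  proof -
    note uv = that
    have "\<not> keys m \<subseteq> {u, v}" if m_in: "m \<in> keys f" for m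
    proof
      assume m: "keys m \<subseteq> {u, v}"
      obtain e where e: "e \<in> E" "e \<subseteq> keys m"
        using *[OF m_in] by blast
      obtain a b where "e = {a, b}" "a \<noteq> b"
        using simple_graph_edgeE[OF simple_V e(1)] by blast
      with e m have "e = {u, v}"
        by auto
      with e(1) nonedgesD(4)[OF uv] show False
        by simp
    qed
    then show "restr u v f = 0"
      by (simp add: restr_eq_0_iff[OF nonedgesD(3)[OF uv]])
  qed
  then show "\<forall>(u, v)\<in>nonedges. restr u v f = 0"
    by blast
next
  assume *: "\<forall>(u, v)\<in>nonedges. restr u v f = 0"
  have "\<exists>e\<in>E. e \<subseteq> keys m" if m: "m \<in> keys f" for m
  proof (rule ccontr)
    assume "\<not> ?thesis"
    moreover have "keys m \<subseteq> V"
      using assms m by (simp add: in_poly_ring_iff)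
    ultimately obtain u v where uv: "(u, v) \<in> nonedges" "keys m \<subseteq> {u, v}"
      using independent_subset_nonedge[of "keys m"] by blast
    then show False
      using * m restr_eq_0_iff[OF nonedgesD(3)[OF uv(1)], of f] by blast
  qed
  then show "f \<in> edge_ideal V E"
    using assms by (simp add: in_edge_ideal_iff[OF simple_V])
qed

subsection \<open>Glueing\<close>

text \<open>The coefficient of a monomial is prescribed by any non-edge containing its support. Two
  such non-edges agree: if they share \<open>u\<close>, only u occurs and t = 0 decides; if they
  share \<open>v\<close>, s = 0 decides; if they are disjoint, the monomial is 1.\<close>

lemma glue:
  fixes w :: "'v \<Rightarrow> 'v \<Rightarrow> 'k::field poly poly"
  assumes w1: "\<And>u v v'. (u, v) \<in> nonedges \<Longrightarrow> (u, v') \<in> nonedges \<Longrightarrow> coeff (w u v) 0 = coeff (w u v') 0"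
    and w2: "\<And>u u' v j. (u, v) \<in> nonedges \<Longrightarrow> (u', v) \<in> nonedges \<Longrightarrow>
      coeff (coeff (w u v) j) 0 = coeff (coeff (w u' v) j) 0"
  shows "\<exists>f\<in>carrier (poly_ring V). \<forall>(u, v)\<in>nonedges. restr u v f = w u v"
proof -
  define c where "c u v m = coeff (coeff (w u v) (lookup m v)) (lookup m u)" for u v and m :: "'v \<Rightarrow>\<^sub>0 nat"
  have c_eq: "c u v m = c u' v' m"
    if uv: "(u, v) \<in> nonedges" "(u', v') \<in> nonedges" and m: "keys m \<subseteq> {u, v}" "keys m \<subseteq> {u', v'}" for u v u' v' m
  proof -
    note D = nonedgesD[OF uv(1)] nonedgesD[OF uv(2)]
    have ne: "u \<noteq> v'" "v \<noteq> u'"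
      using D disjoint by auto
    consider "u = u'" "v = v'" | "u = u'" "v \<noteq> v'" | "u \<noteq> u'" "v = v'" | "u \<noteq> u'" "v \<noteq> v'"
      by blast
    then show ?thesis
    proof cases
      case 2
      have "v \<notin> keys m" "v' \<notin> keys m"
        using m D ne 2 by auto
      moreover have "coeff (w u v) 0 = coeff (w u v') 0"
        by (rule w1) (use uv 2 in simp_all)
      ultimately show ?thesis
        by (simp add: c_def 2(1)[symmetric] in_keys_iff)
    next
      case 3
      have "u \<notin> keys m" "u' \<notin> keys m"
        using m D ne 3 by auto
      moreover have "coeff (coeff (w u v) j) 0 = coeff (coeff (w u' v) j) 0" for j
        by (rule w2) (use uv 3 in simp_all)
      ultimately show ?thesis
        by (simp add: c_def 3(2)[symmetric] in_keys_iff)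
    next
      case 4
      have "u \<notin> keys m" "u' \<notin> keys m" "v \<notin> keys m" "v' \<notin> keys m"
        using m D ne 4 by auto
      then have 0: "lookup m u = 0" "lookup m u' = 0" "lookup m v = 0" "lookup m v' = 0"
        by (simp_all add: in_keys_iff)
      \<comment> \<open>The constant terms are carried from one non-edge to the other through the
        non-edges at a common non-neighbour \<open>b\<close>.\<close>
      obtain b where b: "(u, b) \<in> nonedges" "(u', b) \<in> nonedges"
        using common_nonneighbour[of u u'] D by (auto simp: nonedges_def)
      have "coeff (coeff (w u v) 0) 0 = coeff (coeff (w u b) 0) 0"
        using w1[OF uv(1) b(1)] by simp
      also have "\<dots> = coeff (coeff (w u' b) 0) 0"
        by (rule w2[OF b])
      also have "\<dots> = coeff (coeff (w u' v') 0) 0"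
        using w1[OF uv(2) b(2)] by simp
      finally show ?thesis
        by (simp add: c_def 0)
    qed simp
  qed
  define good where "good m e \<longleftrightarrow> e \<in> nonedges \<and> keys m \<subseteq> {fst e, snd e}" for m :: "'v \<Rightarrow>\<^sub>0 nat" and e
  define L where "L m = (if \<exists>e. good m e then (let e = SOME e. good m e in c (fst e) (snd e) m) else 0)" for m
  have L_eq: "L m = c u v m" if "(u, v) \<in> nonedges" "keys m \<subseteq> {u, v}" for u v m
  proof -
    have ex: "\<exists>e. good m e"
      using that by (intro exI[of _ "(u, v)"]) (simp add: good_def)
    define e where "e = (SOME e. good m e)"
    have "good m e"
      unfolding e_def by (rule someI_ex[OF ex])
    then show ?thesis
      using ex c_eq[of "fst e" "snd e" u v m] that by (simp add: L_def e_def[symmetric] good_def)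
  qed
  \<comment> \<open>These polynomials serve to show that \<open>L\<close> has finite support: each
    \<open>w u v\<close> has only finitely many terms, and there are finitely many
    non-edges.\<close>
  define W where "W u v = subst2 (single 0) (xvar u) (xvar v) (w u v)" for u v
  have W: "lookup (W u v) m = c u v m" if "(u, v) \<in> nonedges" "keys m \<subseteq> {u, v}" for u v m
  proof -
    have uv: "u \<noteq> v"
      by (rule nonedgesD[OF that(1)])
    have "c u v m = coeff (coeff (restr u v (W u v)) (lookup m v)) (lookup m u)"
      using uv unfolding W_def c_def by (subst restr_subst2) (simp_all add: restr_xvar)
    also have "\<dots> = lookup (W u v) m"
      using two_vars_eqI[OF that(2) uv] by (simp add: coeff_restr[OF uv])
    finally show ?thesis ..
  qed
  have sub: "{m. L m \<noteq> 0} \<subseteq> (\<Union>(u, v)\<in>nonedges. keys (W u v) \<inter> {m. keys m \<subseteq> {u, v}})"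
  proof
    fix m assume m: "m \<in> {m. L m \<noteq> 0}"
    then obtain u v where uv: "(u, v) \<in> nonedges" "keys m \<subseteq> {u, v}"
      by (auto simp: L_def good_def split: if_splits)
    have "lookup (W u v) m = L m"
      using L_eq[OF uv] W[OF uv] by simp
    then have "m \<in> keys (W u v)"
      using m by (simp add: in_keys_iff)
    with uv show "m \<in> (\<Union>(u, v)\<in>nonedges. keys (W u v) \<inter> {m. keys m \<subseteq> {u, v}})"
      by blast
  qed
  have "finite {m. L m \<noteq> 0}"
    by (rule finite_subset[OF sub]) (auto simp: finite_nonedges)
  then have lookup: "lookup (Abs_poly_mapping L) = L"
    by simp
  have "keys m \<subseteq> V" if "m \<in> keys (Abs_poly_mapping L)" for m
  proof -
    have "L m \<noteq> 0"
      using that by (simp add: in_keys_iff lookup)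
    then obtain u v where "(u, v) \<in> nonedges" "keys m \<subseteq> {u, v}"
      using sub by blast
    then show ?thesis
      using nonedgesD(5,6) by blast
  qed
  then have "Abs_poly_mapping L \<in> carrier (poly_ring V)"
    by (simp add: in_poly_ring_iff)
  moreover have "restr u v (Abs_poly_mapping L) = w u v" if uv: "(u, v) \<in> nonedges" for u v
  proof -
    have ne: "u \<noteq> v"
      by (rule nonedgesD[OF uv])
    have "coeff (coeff (restr u v (Abs_poly_mapping L)) j) i = coeff (coeff (w u v) j) i" for i j
    proof -
      have "keys (single u i + single v j) \<subseteq> {u, v}"
        by (auto simp: keys_add_nat split: if_splits)
      then show ?thesis
        using ne L_eq[OF uv] by (simp add: coeff_restr[OF ne] lookup c_def lookup_add lookup_single when_def)
    qed
    then show ?thesis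
      by (simp add: poly_eq_iff)
  qed
  ultimately show ?thesis
    by blast
qed

end

section \<open>The quotient ring, its projection, and the elements theta1 and theta2\<close>

lemma a_inv_poly_ring:
  fixes f :: "('v, 'k::field) mpoly"
  assumes "f \<in> carrier (poly_ring V)"
  shows "\<ominus>\<^bsub>poly_ring V\<^esub> f = - f"
proof -
  interpret cring "poly_ring V :: ('v, 'k) mpoly ring"
    by (rule cring_poly_ring)
  show ?thesis
    using assms by (intro minus_equality) (auto simp: poly_ring_closed)
qed

text \<open>The parameter \<open>K\<close> pins down the coefficient field, which the graph alone
  does not determine.\<close>

locale two_cliques_ring = two_cliques V1 V2 E
  for V1 V2 :: "'v set" and E :: "'v set set" +
  fixes K :: "'k::field itself"
begin

abbreviation R :: "('v, 'k) mpoly ring" where "R \<equiv> poly_ring V"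

definition I :: "('v, 'k) mpoly set" where "I = edge_ideal V E"

abbreviation A :: "('v, 'k) mpoly set ring" where "A \<equiv> R Quot I"

definition proj :: "('v, 'k) mpoly \<Rightarrow> ('v, 'k) mpoly set" where "proj f = I +>\<^bsub>R\<^esub> f"

lemma ideal_I: "ideal I R"
  unfolding I_def by (rule ideal_edge_ideal[OF simple_V])

lemma in_I_iff: "f \<in> carrier R \<Longrightarrow> f \<in> I \<longleftrightarrow> (\<forall>(u, v)\<in>nonedges. restr u v f = 0)"
  unfolding I_def by (rule in_edge_ideal_iff_restr)

lemma cring_A: "cring A"
  by (rule ideal.quotient_is_cring[OF ideal_I cring_poly_ring])

lemma proj_hom: "ring_hom_cring R A proj"
  using ideal.rcos_ring_hom_cring[OF ideal_I cring_poly_ring] by (simp add: proj_def[abs_def])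

lemma proj_simps:
  assumes "f \<in> carrier R" "g \<in> carrier R"
  shows "proj f \<in> carrier A" "proj (f + g) = proj f \<oplus>\<^bsub>A\<^esub> proj g" "proj (f * g) = proj f \<otimes>\<^bsub>A\<^esub> proj g"
proof -
  interpret ring_hom_cring R A proj
    by (rule proj_hom)
  show "proj f \<in> carrier A" "proj (f + g) = proj f \<oplus>\<^bsub>A\<^esub> proj g" "proj (f * g) = proj f \<otimes>\<^bsub>A\<^esub> proj g"
    using hom_closed[OF assms(1)] hom_add[OF assms] hom_mult[OF assms] by simp_all
qed

lemma proj_one: "proj 1 = \<one>\<^bsub>A\<^esub>"
  by (simp add: FactRing_def proj_def)

lemma proj_eq_iff:
  assumes "f \<in> carrier R" "g \<in> carrier R"
  shows "proj f = proj g \<longleftrightarrow> f - g \<in> I"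
  using ring.quotient_eq_iff_same_a_r_cos[OF cring.axioms(1)[OF cring_poly_ring] ideal_I assms] assms
  by (simp add: proj_def a_minus_def a_inv_poly_ring)

lemma proj_zero: "proj 0 = \<zero>\<^bsub>A\<^esub>"
  using ring.a_rcos_zero[OF cring.axioms(1)[OF cring_poly_ring] ideal_I ideal_poly_ringD(2)[OF ideal_I]]
  by (simp add: FactRing_def proj_def)

lemma proj_eq_zero_iff: "f \<in> carrier R \<Longrightarrow> proj f = \<zero>\<^bsub>A\<^esub> \<longleftrightarrow> f \<in> I"
  using proj_eq_iff[of f 0] by (simp add: proj_zero)

lemma proj_surj: "x \<in> carrier A \<Longrightarrow> \<exists>f\<in>carrier R. x = proj f"
  by (auto simp: FactRing_def A_RCOSETS_def' proj_def)

lemma ideal_proj_vimage: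
  assumes "ideal J A"
  shows "ideal {f \<in> carrier R. proj f \<in> J} R"
proof -
  interpret ring_hom_cring R A proj
    by (rule proj_hom)
  show ?thesis
    by (rule ring.ideal_vimage[OF assms])
qed

text \<open>On each edge of the complement, \<open>theta1\<close> and \<open>theta2\<close> restrict to its two variables.\<close>

definition theta1 :: "('v, 'k) mpoly" where "theta1 = (\<Sum>u\<in>V1. xvar u)"
definition theta2 :: "('v, 'k) mpoly" where "theta2 = (\<Sum>v\<in>V2. xvar v)"

lemma theta_in_R: "theta1 \<in> carrier R" "theta2 \<in> carrier R"
  unfolding theta1_def theta2_def by (intro sum_in_poly_ring xvar_in_poly_ring, simp add: V_def)+

text \<open>Exactly one variable of each clique survives at a non-edge. The reversed order exchanges
  the roles of theta1 and theta2, so that one argument yields both p(theta1) and q(theta2).\<close>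

lemma restr_theta:
  assumes "(u, v) \<in> nonedges"
  shows "restr u v theta1 = [:[:0, 1:]:]" "restr u v theta2 = [:0, 1:]"
    "restr v u theta1 = [:0, 1:]" "restr v u theta2 = [:[:0, 1:]:]"
proof -
  note D = nonedgesD[OF assms]
  have ne: "v \<noteq> u"
    using D(3) by simp
  have notin: "u \<notin> V2" "v \<notin> V1"
    using D disjoint by auto
  note r = ring_morphD(8)[OF ring_morph_restr[OF D(3)]] ring_morphD(8)[OF ring_morph_restr[OF ne]]
  have sums: "(\<Sum>w\<in>V1. if w = u then x else if w = v then y else 0) = x"
    "(\<Sum>w\<in>V2. if w = u then x else if w = v then y else 0) = y"
    "(\<Sum>w\<in>V1. if w = v then x else if w = u then y else 0) = y"
    "(\<Sum>w\<in>V2. if w = v then x else if w = u then y else 0) = x" for x y :: "'k poly poly"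
  proof -
    have "(\<Sum>w\<in>V1. if w = u then x else if w = v then y else 0) = (\<Sum>w\<in>V1. if w = u then x else 0)"
      using notin by (intro sum.cong) auto
    then show "(\<Sum>w\<in>V1. if w = u then x else if w = v then y else 0) = x"
      using D(1) finite by simp
    have "(\<Sum>w\<in>V2. if w = u then x else if w = v then y else 0) = (\<Sum>w\<in>V2. if w = v then y else 0)"
      using notin by (intro sum.cong) auto
    then show "(\<Sum>w\<in>V2. if w = u then x else if w = v then y else 0) = y"
      using D(2) finite by simp
    have "(\<Sum>w\<in>V1. if w = v then x else if w = u then y else 0) = (\<Sum>w\<in>V1. if w = u then y else 0)"
      using notin by (intro sum.cong) auto
    then show "(\<Sum>w\<in>V1. if w = v then x else if w = u then y else 0) = y"
      using D(1) finite by simp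
    have "(\<Sum>w\<in>V2. if w = v then x else if w = u then y else 0) = (\<Sum>w\<in>V2. if w = v then x else 0)"
      using notin by (intro sum.cong) auto
    then show "(\<Sum>w\<in>V2. if w = v then x else if w = u then y else 0) = x"
      using D(2) finite by simp
  qed
  show "restr u v theta1 = [:[:0, 1:]:]" "restr u v theta2 = [:0, 1:]"
    "restr v u theta1 = [:0, 1:]" "restr v u theta2 = [:[:0, 1:]:]"
    by (simp_all add: theta1_def theta2_def r restr_xvar[OF D(3)] restr_xvar[OF ne] sums)
qed

abbreviation lift :: "'k poly poly \<Rightarrow> ('v, 'k) mpoly" where
  "lift \<equiv> subst2 (single 0) theta1 theta2"

lemma lift_in_R: "lift g \<in> carrier R"
  by (intro subst2_in_poly_ring theta_in_R)

lemma restr_lift: "(u, v) \<in> nonedges \<Longrightarrow> restr u v (lift g) = g"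
  by (intro restr_subst2 restr_theta nonedgesD)

subsection \<open>Prime ideals of the quotient\<close>

text \<open>The endpoints of an edge have product 0 in \<open>A\<close>, so the variables outside
  \<open>Q\<close> form an independent set and lie in one non-edge. All other variables are in
  \<open>Q\<close>, hence so is every term that the restriction kills.\<close>

lemma prime_contains_kernel:
  assumes "primeideal Q A"
  shows "\<exists>(u, v)\<in>nonedges. \<forall>f\<in>carrier R. restr u v f = 0 \<longrightarrow> proj f \<in> Q"
proof -
  interpret Q: primeideal Q A
    by (rule assms)
  note Q' = ideal_poly_ringD[OF ideal_proj_vimage[OF Q.is_ideal]]
  define W where "W = {w \<in> V. proj (xvar w) \<notin> Q}"
  have "\<exists>(u, v)\<in>nonedges. W \<subseteq> {u, v}"
  proof (rule independent_subset_nonedge)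
    show "W \<subseteq> V"
      by (auto simp: W_def)
    fix e assume e: "e \<in> E"
    show "\<not> e \<subseteq> W"
    proof
      assume eW: "e \<subseteq> W"
      obtain a b where ab: "e = {a, b}" "a \<in> V" "b \<in> V"
        using simple_graph_edgeE[OF simple_V e] by blast
      have in_R: "xvar a \<in> carrier R" "xvar b \<in> carrier R"
        using ab by (auto intro: xvar_in_poly_ring)
      have "\<exists>e\<in>E. e \<subseteq> keys m" if "m \<in> keys (xvar a * xvar b :: ('v, 'k) mpoly)" for m
        using that e ab(1) by (intro bexI[of _ e]) (auto simp: xvar_mult keys_add_nat)
      then have "xvar a * xvar b \<in> I"
        unfolding I_def in_edge_ideal_iff[OF simple_V] using in_R poly_ring_closed(2) by blast
      then have "proj (xvar a * xvar b) = \<zero>\<^bsub>A\<^esub>"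
        using proj_eq_zero_iff poly_ring_closed in_R by blast
      then have "proj (xvar a) \<otimes>\<^bsub>A\<^esub> proj (xvar b) \<in> Q"
        using proj_simps(3)[OF in_R] additive_subgroup.zero_closed[OF Q.is_additive_subgroup] by simp
      then have "proj (xvar a) \<in> Q \<or> proj (xvar b) \<in> Q"
        using Q.I_prime proj_simps(1)[OF in_R] proj_simps(1)[OF in_R(2,1)] by blast
      then show False
        using eW ab by (auto simp: W_def)
    qed
  qed
  then obtain u v where uv: "(u, v) \<in> nonedges" "W \<subseteq> {u, v}"
    by blast
  have "proj f \<in> Q" if f: "f \<in> carrier R" "restr u v f = 0" for f
  proof -
    have "single m (lookup f m) \<in> {f \<in> carrier R. proj f \<in> Q}" if m: "m \<in> keys f" for m
    proof -
      have mV: "keys m \<subseteq> V"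
        using f(1) m by (simp add: in_poly_ring_iff)
      obtain w where w: "w \<in> keys m" "w \<notin> {u, v}"
        using f(2) m restr_eq_0_iff[OF nonedgesD(3)[OF uv(1)], of f] by blast
      then have "w \<in> V" "w \<notin> W"
        using mV uv(2) by blast+
      then have x: "xvar w \<in> {f \<in> carrier R. proj f \<in> Q}"
        by (auto simp: W_def intro: xvar_in_poly_ring)
      define m' where "m' = m - single w 1"
      have m': "m = m' + single w 1"
      proof (rule poly_mapping_eqI)
        fix k
        show "lookup m k = lookup (m' + single w 1) k"
          using w(1) by (auto simp: m'_def lookup_add lookup_minus lookup_single when_def in_keys_iff)
      qed
      have "keys m' \<subseteq> V"
        using mV m' by (simp add: keys_add_nat)
      then have "single m' (lookup f m) * xvar w \<in> {f \<in> carrier R. proj f \<in> Q}"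
        by (intro Q'(4)[OF _ x] single_in_poly_ring)
      then show ?thesis
        by (simp only: xvar_def mult_single mult_1_right m'[symmetric])
    qed
    then have "(\<Sum>m\<in>keys f. single m (lookup f m)) \<in> {f \<in> carrier R. proj f \<in> Q}"
      by (rule Q'(6))
    then show ?thesis
      by (simp add: sum_single_lookup)
  qed
  with uv show ?thesis
    by blast
qed

text \<open>One non-edge serves the whole chain, since the kernel of its restriction lies in the
  smallest prime. Contracting along \<open>lift\<close> then gives a chain in K[s][t].\<close>

lemma no_prime_chain:
  fixes Q :: "nat \<Rightarrow> ('v, 'k) mpoly set set"
  assumes prime: "\<And>i. i \<le> 3 \<Longrightarrow> primeideal (Q i) A" and strict: "\<And>i. i < 3 \<Longrightarrow> Q i \<subset> Q (Suc i)"
  shows False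
proof -
  obtain u v where uv: "(u, v) \<in> nonedges" and ker: "\<And>f. f \<in> carrier R \<Longrightarrow> restr u v f = 0 \<Longrightarrow> proj f \<in> Q 0"
    using prime_contains_kernel[OF prime[of 0]] by auto
  have mono: "Q 0 \<subseteq> Q i" if "i \<le> 3" for i
    using that
  proof (induction i)
    case (Suc i)
    then show ?case
      using strict[of i] by auto
  qed simp
  note r = ring_morphD[OF ring_morph_restr[OF nonedgesD(3)[OF uv]]]
  have ring_morph_lift: "ring_morph lift"
    by (intro ring_morph_subst2 ring_morph_const)
  note l = ring_morphD[OF ring_morph_lift]
  define P where "P i = {g. proj (lift g) \<in> Q i}" for i
  have ideal: "ideal {f \<in> carrier R. proj f \<in> Q i} R" if "i \<le> 3" for i
    using prime[OF that] by (intro ideal_proj_vimage) (rule primeideal.axioms(1))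
  have P_eq: "g \<in> P i \<longleftrightarrow> lift g \<in> {f \<in> carrier R. proj f \<in> Q i}" for g i
    by (simp add: P_def lift_in_R)
  show False
  proof (rule no_prime_chain_of_length_3[of P])
    show "x \<in> P n \<or> y \<in> P n" if "n \<le> 3" "x * y \<in> P n" for n x y
    proof -
      have "proj (lift x) \<otimes>\<^bsub>A\<^esub> proj (lift y) \<in> Q n"
        using that(2) by (simp add: P_def l(2) flip: proj_simps(3)[OF lift_in_R lift_in_R])
      then show ?thesis
        using primeideal.I_prime[OF prime[OF that(1)]] proj_simps(1)[OF lift_in_R lift_in_R]
        by (auto simp: P_def)
    qed
    show "0 \<in> P 0"
      using ker[of 0] by (simp add: P_def l(4) r(4))
    show "x + y \<in> P n" if "n \<le> 3" "x \<in> P n" "y \<in> P n" for n x y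
      using ideal_poly_ringD(3)[OF ideal[OF that(1)]] that(2,3) by (simp only: P_eq l(1))
    show "y * x \<in> P n" if "n \<le> 3" "x \<in> P n" for n x y
      using ideal_poly_ringD(4)[OF ideal[OF that(1)] lift_in_R[of y]] that(2) by (simp only: P_eq l(2))
    show "1 \<notin> P 3"
    proof
      assume "1 \<in> P 3"
      then have "\<one>\<^bsub>A\<^esub> \<in> Q 3"
        by (simp add: P_def l(3) proj_one)
      then show False
        using prime[of 3] ideal.one_imp_carrier[of "Q 3" A] primeideal.I_notcarr[of "Q 3" A]
        by (auto dest: primeideal.axioms(1))
    qed
    show "P n \<subset> P (Suc n)" if n3: "n < 3" for n
    proof -
      have "P n \<subseteq> P (Suc n)"
        using strict[OF n3] by (auto simp: P_def)
      moreover obtain x where x: "x \<in> Q (Suc n)" "x \<notin> Q n"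
        using strict[OF n3] by blast
      have "x \<in> carrier A"
        using x(1) prime[of "Suc n"] n3 by (auto dest: primeideal.axioms(1) ideal.Icarr)
      then obtain f where f: "f \<in> carrier R" "x = proj f"
        using proj_surj by blast
      \<comment> \<open>The polynomials \<open>f\<close> and \<open>lift (restr u v f)\<close> have
        equal restrictions, so their difference lies in every prime of the chain, and the
        contraction loses no strict inclusion.\<close>
      have d: "f - lift (restr u v f) \<in> carrier R" "lift (restr u v f) - f \<in> carrier R"
        using f(1) lift_in_R by (auto intro: poly_ring_closed)
      have d_in: "f - lift (restr u v f) \<in> {f \<in> carrier R. proj f \<in> Q i}" if "i \<le> 3" for i
        using ker[OF d(1)] mono[OF that] d(1) by (auto simp: r(6) restr_lift[OF uv])
      have "restr u v f \<notin> P n"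
      proof
        assume "restr u v f \<in> P n"
        then have "(f - lift (restr u v f)) + lift (restr u v f) \<in> {f \<in> carrier R. proj f \<in> Q n}"
          using n3 by (intro ideal_poly_ringD(3)[OF ideal d_in]) (auto simp: P_eq)
        then show False
          using x(2) f(2) by simp
      qed
      moreover have "f - (f - lift (restr u v f)) \<in> {f \<in> carrier R. proj f \<in> Q (Suc n)}"
        using n3 x(1) f by (intro ideal_poly_ringD(5)[OF ideal _ d_in]) auto
      then have "restr u v f \<in> P (Suc n)"
        by (simp add: P_eq)
      ultimately show ?thesis
        by blast
    qed
  qed
qed

section \<open>Regular sequences of length two in every maximal ideal\<close>

text \<open>The contraction of \<open>M\<close> to K[s][t] is again maximal, so it contains some
  p(s). The elements \<open>a\<close>, \<open>b\<close> and the order of \<open>u\<close>,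
  \<open>v\<close> stay free so that the two cliques can be interchanged.\<close>

lemma maximal_contains_univariate:
  assumes M: "maximalideal M A" and uv: "u \<noteq> v"
    and ker: "\<And>f. f \<in> carrier R \<Longrightarrow> restr u v f = 0 \<Longrightarrow> proj f \<in> M"
    and a: "a \<in> carrier R" "restr u v a = [:[:0, 1:]:]"
    and b: "b \<in> carrier R" "restr u v b = [:0, 1:]"
  shows "\<exists>p. p \<noteq> 0 \<and> proj (subst_poly (single 0) a p) \<in> M"
proof -
  interpret A: cring A
    by (rule cring_A)
  interpret M: maximalideal M A
    by (rule M)
  note r = ring_morphD[OF ring_morph_restr[OF uv]]
  define ev where "ev = subst2 (single 0) a b"
  have "ring_morph ev"
    unfolding ev_def by (intro ring_morph_subst2 ring_morph_const)
  note e = ring_morphD[OF this]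
  have ev_R: "ev g \<in> carrier R" for g
    unfolding ev_def by (intro subst2_in_poly_ring a b)
  have restr_ev: "restr u v (ev g) = g" for g
    unfolding ev_def by (rule restr_subst2[OF uv a(2) b(2)])
  define M' where "M' = {f \<in> carrier R. proj f \<in> M}"
  have "ideal M' R"
    unfolding M'_def by (rule ideal_proj_vimage[OF M.is_ideal])
  note M'D = ideal_poly_ringD[OF this]
  define m where "m = {g. ev g \<in> M'}"
  have "\<exists>p. p \<noteq> 0 \<and> [:p:] \<in> m"
  proof (rule maximal_ideal_contains_const)
    show "x + y \<in> m" if "x \<in> m" "y \<in> m" for x y
      using that M'D(3) by (simp add: m_def e(1))
    show "y * x \<in> m" if "x \<in> m" for x y
      using that M'D(4)[OF ev_R] by (simp add: m_def e(2))
    show "1 \<notin> m"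
    proof
      assume "1 \<in> m"
      then have "\<one>\<^bsub>A\<^esub> \<in> M"
        by (simp add: m_def e(3) M'_def proj_one)
      then show False
        using M.one_imp_carrier M.I_notcarr by blast
    qed
    show "\<exists>y. x * y - 1 \<in> m" if x: "x \<notin> m" for x
    proof -
      let ?x = "proj (ev x)"
      have xA: "?x \<in> carrier A"
        by (rule proj_simps(1)[OF ev_R ev_R])
      have xM: "?x \<notin> M"
        using x ev_R by (simp add: m_def M'_def)
      define J where "J = M <+>\<^bsub>A\<^esub> PIdl\<^bsub>A\<^esub> ?x"
      have J: "ideal J A"
        unfolding J_def using M.is_ideal xA by (intro A.add_ideals A.cgenideal_ideal)
      have P0: "\<zero>\<^bsub>A\<^esub> \<in> PIdl\<^bsub>A\<^esub> ?x"
        using ideal.axioms(1)[OF A.cgenideal_ideal[OF xA]] by (rule additive_subgroup.zero_closed)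
      have "M \<subseteq> J"
      proof
        fix y assume y: "y \<in> M"
        then have "y \<oplus>\<^bsub>A\<^esub> \<zero>\<^bsub>A\<^esub> = y"
          by (intro A.r_zero M.Icarr)
        with y P0 show "y \<in> J"
          unfolding J_def set_add_def' by force
      qed
      moreover have "?x \<in> J"
      proof -
        have "\<zero>\<^bsub>A\<^esub> \<oplus>\<^bsub>A\<^esub> ?x = ?x"
          by (rule A.l_zero[OF xA])
        then show ?thesis
          unfolding J_def set_add_def'
          using A.cgenideal_self[OF xA] additive_subgroup.zero_closed[OF M.is_additive_subgroup] by force
      qed
      ultimately have "J = carrier A"
        using M.I_maximal[OF J] xM ideal.Icarr[OF J] by blast
      then have "\<one>\<^bsub>A\<^esub> \<in> J"
        by simp
      then obtain y z where y: "y \<in> M" and z: "z \<in> carrier A" and eq: "\<one>\<^bsub>A\<^esub> = y \<oplus>\<^bsub>A\<^esub> z \<otimes>\<^bsub>A\<^esub> ?x"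
        by (auto simp: J_def set_add_def' cgenideal_def)
      obtain f where f: "f \<in> carrier R" "y = proj f"
        using proj_surj M.Icarr[OF y] by blast
      obtain g where g: "g \<in> carrier R" "z = proj g"
        using proj_surj z by blast
      have gx: "g * ev x \<in> carrier R"
        using g ev_R by (intro poly_ring_closed)
      have fgx: "f + g * ev x \<in> carrier R"
        by (rule poly_ring_closed(1)[OF f(1) gx])
      have "proj (f + g * ev x) = proj 1"
        using eq f g by (simp add: proj_one proj_simps(2)[OF f(1) gx] proj_simps(3)[OF g(1) ev_R])
      then have "f + g * ev x - 1 \<in> I"
        using proj_eq_iff[OF fgx one_in_poly_ring] by blast
      then have "proj (f + g * ev x - 1) \<in> M"
        using proj_eq_zero_iff[of "f + g * ev x - 1"] poly_ring_closed(4)[OF fgx one_in_poly_ring]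
          additive_subgroup.zero_closed[OF M.is_additive_subgroup] by simp
      then have 1: "f + g * ev x - 1 \<in> M'"
        using poly_ring_closed(4)[OF fgx one_in_poly_ring] by (simp add: M'_def)
      have 2: "f \<in> M'"
        using f y by (simp add: M'_def)
      \<comment> \<open>The inverse is represented by \<open>g\<close>, which need not come from
        K[s][t]. Replacing it by \<open>ev (restr u v g)\<close> changes it by an element of the
        kernel, which \<open>M\<close> contains.\<close>
      have dR: "g - ev (restr u v g) \<in> carrier R"
        using g ev_R by (intro poly_ring_closed)
      then have "g - ev (restr u v g) \<in> M'"
        using ker[OF dR] by (simp add: M'_def r(6) restr_ev)
      then have 3: "ev x * (g - ev (restr u v g)) \<in> M'"
        by (rule M'D(4)[OF ev_R])
      have "(f + g * ev x - 1) - f - ev x * (g - ev (restr u v g)) \<in> M'"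
        by (intro M'D(5) 1 2 3)
      also have "(f + g * ev x - 1) - f - ev x * (g - ev (restr u v g)) = ev (x * restr u v g - 1)"
        by (simp add: e algebra_simps)
      finally show ?thesis
        by (auto simp: m_def)
    qed
  qed
  then obtain p where p: "p \<noteq> 0" "[:p:] \<in> m"
    by blast
  then have "proj (subst_poly (single 0) a p) \<in> M"
    by (simp add: m_def M'_def ev_def subst2_const ring_morph_const)
  with p(1) show ?thesis
    by blast
qed

text \<open>
  With \<open>p(s)\<close> and \<open>q(t)\<close> in the contraction of the maximal ideal, \<open>p(theta1), q(theta2)\<close> is regular: on each
  edge of the complement it is \<open>p(s), q(t)\<close>, and quotients of compatible families by \<open>p(s)\<close> are compatible.
\<close>

lemma regular_sequence_in_maximal:
  assumes M: "maximalideal M A"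
  shows "\<exists>a b. a \<in> M \<and> b \<in> M \<and> regular_sequence A [a, b]"
proof -
  interpret A: cring A
    by (rule cring_A)
  interpret M: maximalideal M A
    by (rule M)
  obtain u v where uv: "(u, v) \<in> nonedges" and ker: "\<And>f. f \<in> carrier R \<Longrightarrow> restr u v f = 0 \<Longrightarrow> proj f \<in> M"
    using prime_contains_kernel[OF A.maximalideal_prime[OF M]] by auto
  have ne: "u \<noteq> v" "v \<noteq> u"
    using nonedgesD(3)[OF uv] by auto
  \<comment> \<open>Vanishing of a restriction depends only on the set of the two vertices.\<close>
  have ker': "proj f \<in> M" if "f \<in> carrier R" "restr v u f = 0" for f
    using ker[OF that(1)] that(2) by (simp add: restr_eq_0_iff ne insert_commute)
  obtain p where p: "p \<noteq> 0" "proj (subst_poly (single 0) theta1 p) \<in> M"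
    using maximal_contains_univariate[OF M ne(1) ker theta_in_R(1) _ theta_in_R(2)] restr_theta[OF uv] by blast
  obtain q where q: "q \<noteq> 0" "proj (subst_poly (single 0) theta2 q) \<in> M"
    using maximal_contains_univariate[OF M ne(2) ker' theta_in_R(2) _ theta_in_R(1)] restr_theta[OF uv] by blast
  define qq where "qq = map_poly (\<lambda>c. [:c:]) q"
  define a where "a = lift [:p:]"
  define b where "b = lift qq"
  have aM: "proj a \<in> M"
    using p(2) by (simp add: a_def subst2_const ring_morph_const)
  have bM: "proj b \<in> M"
    using q(2) by (simp add: b_def qq_def subst2_inner_const ring_morph_const)
  have ab_R: "a \<in> carrier R" "b \<in> carrier R"
    by (simp_all add: a_def b_def lift_in_R)
  have restr_ab: "restr u v a = [:p:]" "restr u v b = qq" if "(u, v) \<in> nonedges" for u v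
    using that by (simp_all add: a_def b_def restr_lift)
  have "regular_sequence A [proj a, proj b]"
  proof (rule A.regular_sequence_pair[OF _ _ M.is_ideal _ aM bM])
    show "proj a \<in> carrier A" "proj b \<in> carrier A"
      using aM bM M.Icarr by auto
    show "M \<noteq> carrier A"
      using M.I_notcarr by simp
    show "y = \<zero>\<^bsub>A\<^esub>" if y: "y \<in> carrier A" "proj a \<otimes>\<^bsub>A\<^esub> y = \<zero>\<^bsub>A\<^esub>" for y
    proof -
      obtain f where f: "f \<in> carrier R" "y = proj f"
        using proj_surj y(1) by blast
      have "a * f \<in> carrier R"
        using ab_R f by (intro poly_ring_closed)
      moreover have "proj (a * f) = \<zero>\<^bsub>A\<^esub>"
        using y(2) f by (simp add: proj_simps(3) ab_R)
      ultimately have 0: "\<forall>(u, v)\<in>nonedges. restr u v (a * f) = 0"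
        using proj_eq_zero_iff in_I_iff by blast
      have "restr u v f = 0" if "(u, v) \<in> nonedges" for u v
      proof -
        have "[:p:] * restr u v f = restr u v (a * f)"
          by (simp only: ring_morphD(2)[OF ring_morph_restr[OF nonedgesD(3)[OF that]]] restr_ab[OF that])
        also have "\<dots> = 0"
          using 0 that by blast
        finally show ?thesis
          using p(1) by simp
      qed
      then have "f \<in> I"
        using in_I_iff[OF f(1)] by blast
      then show ?thesis
        using f proj_eq_zero_iff by simp
    qed
    show "\<exists>w\<in>carrier A. y = proj a \<otimes>\<^bsub>A\<^esub> w"
      if yz: "y \<in> carrier A" "z \<in> carrier A" "proj b \<otimes>\<^bsub>A\<^esub> y = proj a \<otimes>\<^bsub>A\<^esub> z" for y z
    proof -
      obtain f where f: "f \<in> carrier R" "y = proj f"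
        using proj_surj yz(1) by blast
      obtain g where g: "g \<in> carrier R" "z = proj g"
        using proj_surj yz(2) by blast
      have bf: "b * f \<in> carrier R" and ag: "a * g \<in> carrier R"
        using ab_R f g by (auto intro: poly_ring_closed)
      have "proj (b * f) = proj (a * g)"
        using yz(3) f g by (simp add: proj_simps(3) ab_R)
      then have "b * f - a * g \<in> I"
        using proj_eq_iff[OF bf ag] by blast
      then have 0: "\<forall>(u, v)\<in>nonedges. restr u v (b * f - a * g) = 0"
        using in_I_iff[OF poly_ring_closed(4)[OF bf ag]] by blast
      have eq: "[:p:] * restr u v g = qq * restr u v f" if "(u, v) \<in> nonedges" for u v
      proof -
        have "qq * restr u v f - [:p:] * restr u v g = restr u v (b * f - a * g)"
          by (simp only: ring_morphD(2,6)[OF ring_morph_restr[OF nonedgesD(3)[OF that]]] restr_ab[OF that])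
        also have "\<dots> = 0"
          using 0 that by blast
        finally show ?thesis
          by simp
      qed
      have "\<exists>w. restr u v f = [:p:] * w" if "(u, v) \<in> nonedges" for u v
        using const_poly_dvd_cancel[OF q(1)] eq[OF that] unfolding qq_def by blast
      then obtain w where w: "\<And>u v. (u, v) \<in> nonedges \<Longrightarrow> restr u v f = [:p:] * w u v"
        by metis
      have w': "restr u v g = qq * w u v" if "(u, v) \<in> nonedges" for u v
      proof -
        have "[:p:] * restr u v g = [:p:] * (qq * w u v)"
          using eq[OF that] w[OF that] by (simp only: mult.left_commute)
        then show ?thesis
          using p(1) by (metis mult_left_cancel pCons_eq_0_iff)
      qed
      have "\<exists>h\<in>carrier R. \<forall>(u, v)\<in>nonedges. restr u v h = w u v"
      proof (rule glue)
        fix u v v' assume uv: "(u, v) \<in> nonedges" "(u, v') \<in> nonedges"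
        note D = nonedgesD[OF uv(1)] nonedgesD[OF uv(2)]
        have "coeff (coeff (restr u v f) 0) i = coeff (coeff (restr u v' f) 0) i" for i
          by (simp add: coeff_restr D)
        then have "coeff (restr u v f) 0 = coeff (restr u v' f) 0"
          by (rule poly_eqI)
        then have "p * coeff (w u v) 0 = p * coeff (w u v') 0"
          using w[OF uv(1)] w[OF uv(2)] by simp
        then show "coeff (w u v) 0 = coeff (w u v') 0"
          using p(1) by simp
      next
        fix u u' v j assume uv: "(u, v) \<in> nonedges" "(u', v) \<in> nonedges"
        note D = nonedgesD[OF uv(1)] nonedgesD[OF uv(2)]
        \<comment> \<open>This sets s = 0. As p may vanish there, the relation f = p(s) w is of no
          use; g = q(t) w is used instead, since q(t) survives as the nonzero
          \<open>q\<close>.\<close>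
        define at0 :: "'k poly poly \<Rightarrow> 'k poly" where "at0 = map_poly (\<lambda>c. coeff c 0)"
        have at0: "coeff (at0 x) i = coeff (coeff x i) 0" for x i
          by (simp add: at0_def coeff_map_poly)
        have at0_mult: "at0 (x * y) = at0 x * at0 y" for x y
          by (rule poly_eqI) (simp add: at0 coeff_mult coeff_sum)
        have at0_qq: "at0 qq = q"
          by (rule poly_eqI) (simp add: at0 qq_def coeff_map_poly)
        have "at0 (restr u v g) = at0 (restr u' v g)"
          by (rule poly_eqI) (simp add: at0 coeff_restr D)
        then have "q * at0 (w u v) = q * at0 (w u' v)"
          using w'[OF uv(1)] w'[OF uv(2)] by (simp add: at0_mult at0_qq)
        then have "at0 (w u v) = at0 (w u' v)"
          using q(1) by simp
        then show "coeff (coeff (w u v) j) 0 = coeff (coeff (w u' v) j) 0"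
          by (simp flip: at0)
      qed
      then obtain h where h: "h \<in> carrier R" "\<And>u v. (u, v) \<in> nonedges \<Longrightarrow> restr u v h = w u v"
        by blast
      have ah: "a * h \<in> carrier R"
        using ab_R h by (intro poly_ring_closed)
      have "restr u v (f - a * h) = 0" if "(u, v) \<in> nonedges" for u v
      proof -
        have "restr u v (f - a * h) = restr u v f - [:p:] * restr u v h"
          by (simp only: ring_morphD(2,6)[OF ring_morph_restr[OF nonedgesD(3)[OF that]]] restr_ab[OF that])
        then show ?thesis
          using w[OF that] h(2)[OF that] by simp
      qed
      then have "f - a * h \<in> I"
        using in_I_iff[OF poly_ring_closed(4)[OF f(1) ah]] by blast
      then have "proj f = proj (a * h)"
        using proj_eq_iff[OF f(1) ah] by blast
      then have "y = proj a \<otimes>\<^bsub>A\<^esub> proj h"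
        using f proj_simps(3)[OF ab_R(1) h(1)] by simp
      then show ?thesis
        using proj_simps(1)[OF h(1) h(1)] by blast
    qed
  qed
  with aM bM show ?thesis
    by blast
qed

end

context two_cliques_ring
begin

subsection \<open>The quotient is Noetherian\<close>

lemma noetherian_type_coords: "noetherian_type TYPE('k poly poly)"
  by (intro noetherian_type_poly noetherian_type_field)

text \<open>For one more non-edge, finitely many elements of \<open>J\<close> generate its image in
  K[s][t]. Subtracting a combination of them leaves an element of the ideal \<open>J'\<close> of
  those members of \<open>J\<close> that vanish on this non-edge, and the induction hypothesis is
  applied to \<open>J'\<close>; this is why \<open>J\<close> must vary.\<close>

lemma ideal_finitely_generated_modulo:
  assumes "finite N" "N \<subseteq> nonedges" "ideal J R"
  shows "\<exists>B\<subseteq>J. finite B \<and> (\<forall>f\<in>J. \<exists>g\<in>genideal R B. \<forall>(u, v)\<in>N. restr u v (f - g) = 0)"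
  using assms
proof (induction N arbitrary: J rule: finite_induct)
  case empty
  interpret R: cring R
    by (rule cring_poly_ring)
  have "0 \<in> genideal R {}"
    using ideal_poly_ringD(2)[OF R.genideal_ideal] by blast
  then show ?case
    by (intro exI[of _ "{}"]) auto
next
  case (insert e N)
  interpret R: cring R
    by (rule cring_poly_ring)
  note JD = ideal_poly_ringD[OF insert.prems(2)]
  obtain u v where e: "e = (u, v)"
    by fastforce
  have uv: "(u, v) \<in> nonedges"
    using insert.prems(1) e by simp
  note r = ring_morphD[OF ring_morph_restr[OF nonedgesD(3)[OF uv]]]
  have "ideal_of_type (restr u v ` J)"
    unfolding ideal_of_type_def
  proof (intro conjI ballI allI)
    show "0 \<in> restr u v ` J"
      by (rule image_eqI[of _ _ 0]) (simp_all add: r(4) JD(2))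
    fix x assume "x \<in> restr u v ` J"
    then obtain f where f: "f \<in> J" "x = restr u v f"
      by blast
    show "y * x \<in> restr u v ` J" for y
      using JD(4)[OF lift_in_R[of y] f(1)] by (intro image_eqI[of _ _ "lift y * f"]) (simp_all add: r(2) restr_lift[OF uv] f(2))
    fix y assume "y \<in> restr u v ` J"
    then obtain g where g: "g \<in> J" "y = restr u v g"
      by blast
    show "x + y \<in> restr u v ` J"
      using JD(3)[OF f(1) g(1)] by (intro image_eqI[of _ _ "f + g"]) (simp_all add: r(1) f g)
  qed
  then have "\<exists>B\<subseteq>restr u v ` J. finite B \<and> (\<forall>x\<in>restr u v ` J. \<exists>c. x = (\<Sum>b\<in>B. c b * b))"
    using noetherian_type_coords by (simp only: noetherian_type_def)
  then obtain B0 where B0: "B0 \<subseteq> restr u v ` J" "finite B0"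
    and gen0: "\<forall>x\<in>restr u v ` J. \<exists>c. x = (\<Sum>b\<in>B0. c b * b)"
    by (elim exE conjE) (rule that)
  define pre where "pre = inv_into J (restr u v)"
  have pre: "pre b \<in> J" "restr u v (pre b) = b" if "b \<in> B0" for b
    using B0(1) that unfolding pre_def by (auto intro: inv_into_into f_inv_into_f)
  define B1 where "B1 = pre ` B0"
  have B1: "B1 \<subseteq> J"
    using pre by (auto simp: B1_def)
  define J' where "J' = {f \<in> J. restr u v f = 0}"
  have J': "ideal J' R"
    by (rule ideal_poly_ringI) (use JD in \<open>auto simp: J'_def r\<close>)
  obtain B2 where B2: "B2 \<subseteq> J'" "finite B2"
    and gen2: "\<And>f. f \<in> J' \<Longrightarrow> \<exists>g\<in>genideal R B2. \<forall>(u, v)\<in>N. restr u v (f - g) = 0"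
    using insert.IH[OF _ J'] insert.prems(1) by auto
  have B12: "B1 \<union> B2 \<subseteq> J" "B1 \<union> B2 \<subseteq> carrier R"
    using B1 B2(1) JD(1) by (auto simp: J'_def)
  have G: "ideal (genideal R (B1 \<union> B2)) R"
    by (rule R.genideal_ideal[OF B12(2)])
  have "\<exists>g\<in>genideal R (B1 \<union> B2). \<forall>(u, v)\<in>insert e N. restr u v (f - g) = 0" if f: "f \<in> J" for f
  proof -
    obtain c where c: "restr u v f = (\<Sum>b\<in>B0. c b * b)"
      using bspec[OF gen0 imageI[OF f]] by (elim exE) (rule that)
    define g1 where "g1 = (\<Sum>b\<in>B0. lift (c b) * pre b)"
    have g1_J: "g1 \<in> J"
      unfolding g1_def by (intro JD(6) JD(4) lift_in_R pre(1))
    have g1_G: "g1 \<in> genideal R (B1 \<union> B2)"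
      unfolding g1_def
    proof (intro ideal_poly_ringD(6)[OF G] ideal_poly_ringD(4)[OF G] lift_in_R)
      show "pre b \<in> genideal R (B1 \<union> B2)" if "b \<in> B0" for b
        using R.genideal_self[OF B12(2)] that by (auto simp: B1_def)
    qed
    have "restr u v g1 = restr u v f"
      unfolding g1_def c r(8) using pre by (intro sum.cong) (auto simp: r(2) restr_lift[OF uv])
    then have "f - g1 \<in> J'"
      using JD(5)[OF f g1_J] by (simp add: J'_def r(6))
    then obtain g2 where g2: "g2 \<in> genideal R B2" "\<forall>(u, v)\<in>N. restr u v (f - g1 - g2) = 0"
      using gen2 by blast
    \<comment> \<open>The second correction stays in \<open>J'\<close>, so it does not spoil the
      agreement already reached on the new non-edge.\<close>
    have "genideal R B2 \<subseteq> J'"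
      by (rule R.genideal_minimal[OF J' B2(1)])
    then have "restr u v (f - g1 - g2) = 0"
      using g2(1) \<open>f - g1 \<in> J'\<close> by (auto simp: J'_def r(6))
    moreover have "genideal R B2 \<subseteq> genideal R (B1 \<union> B2)"
      using R.genideal_self[OF B12(2)] by (intro R.genideal_minimal[OF G]) blast
    then have "g1 + g2 \<in> genideal R (B1 \<union> B2)"
      using g2(1) by (intro ideal_poly_ringD(3)[OF G g1_G]) blast
    ultimately show ?thesis
      using g2(2) by (intro bexI[of _ "g1 + g2"]) (simp_all add: e diff_diff_eq)
  qed
  with B12(1) B2(2) B0(2) show ?case
    by (intro exI[of _ "B1 \<union> B2"]) (simp add: B1_def)
qed

text \<open>Polynomials agreeing on all non-edges are equal in \<open>A\<close>, so generation
  modulo the restrictions becomes generation of the ideal itself.\<close>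

lemma noetherian_A: "noetherian_ring A"
proof (rule ring.noetherian_ringI)
  interpret A: cring A
    by (rule cring_A)
  interpret R: cring R
    by (rule cring_poly_ring)
  show "ring A"
    by (rule A.ring_axioms)
  fix J assume J: "ideal J A"
  define J' where "J' = {f \<in> carrier R. proj f \<in> J}"
  have J': "ideal J' R"
    unfolding J'_def by (rule ideal_proj_vimage[OF J])
  obtain B where B: "B \<subseteq> J'" "finite B"
    and gen: "\<And>f. f \<in> J' \<Longrightarrow> \<exists>g\<in>genideal R B. \<forall>(u, v)\<in>nonedges. restr u v (f - g) = 0"
    using ideal_finitely_generated_modulo[OF finite_nonedges order_refl J'] by blast
  have BR: "B \<subseteq> carrier R"
    using B(1) by (auto simp: J'_def)
  have BA: "proj ` B \<subseteq> carrier A"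
    using BR proj_simps(1) by blast
  have G: "ideal (genideal A (proj ` B)) A"
    by (rule A.genideal_ideal[OF BA])
  have sub: "genideal R B \<subseteq> {f \<in> carrier R. proj f \<in> genideal A (proj ` B)}"
    using A.genideal_self[OF BA] BR by (intro R.genideal_minimal[OF ideal_proj_vimage[OF G]]) blast
  have "J = genideal A (proj ` B)"
  proof
    show "genideal A (proj ` B) \<subseteq> J"
      using B(1) by (intro A.genideal_minimal[OF J]) (auto simp: J'_def)
    show "J \<subseteq> genideal A (proj ` B)"
    proof
      fix x assume x: "x \<in> J"
      then obtain f where f: "f \<in> carrier R" "x = proj f"
        using proj_surj ideal.Icarr[OF J] by blast
      then obtain g where g: "g \<in> genideal R B" "\<forall>(u, v)\<in>nonedges. restr u v (f - g) = 0"
        using gen[of f] x by (auto simp: J'_def)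
      have gR: "g \<in> carrier R"
        using g(1) sub by blast
      have "f - g \<in> I"
        using in_I_iff[OF poly_ring_closed(4)[OF f(1) gR]] g(2) by blast
      then have "proj f = proj g"
        using proj_eq_iff[OF f(1) gR] by blast
      then show "x \<in> genideal A (proj ` B)"
        using f(2) g(1) sub by auto
    qed
  qed
  with BA B(2) show "\<exists>B\<subseteq>carrier A. finite B \<and> J = genideal A B"
    by blast
qed

lemma cohen_macaulay_A: "cohen_macaulay_ring A"
  by (rule cohen_macaulay_ringI_dim_2[OF cring_A noetherian_A regular_sequence_in_maximal])
    (use no_prime_chain in blast)+

end

lemma (in two_cliques) cohen_macaulay_graph_two_cliques:
  "cohen_macaulay_graph TYPE('k::field) (V1 \<union> V2) E"
proof -
  interpret two_cliques_ring V1 V2 E "TYPE('k)"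
    by unfold_locales
  show ?thesis
    using cohen_macaulay_A by (simp add: cohen_macaulay_graph_def I_def V_def)
qed

section \<open>Facet and non-face complexes of edge ideals\<close>

definition mono_of :: "'v set \<Rightarrow> ('v \<Rightarrow>\<^sub>0 nat)" where
  "mono_of F = (\<Sum>v\<in>F. single v 1)"

lemma lookup_mono_of: "finite F \<Longrightarrow> lookup (mono_of F) v = (if v \<in> F then 1 else 0)"
  by (simp add: mono_of_def lookup_sum lookup_single when_def)

lemma keys_mono_of: "finite F \<Longrightarrow> keys (mono_of F) = F"
  by (auto simp: in_keys_iff lookup_mono_of split: if_splits)

lemma xprod_eq: "xprod F = single (mono_of F) 1"
  by (induction F rule: infinite_finite_induct) (simp_all add: xprod_def mono_of_def xvar_def mult_single)

lemma mono_of_dvdD: "finite F \<Longrightarrow> finite F' \<Longrightarrow> mono_of F' = mono_of F + m \<Longrightarrow> F \<subseteq> F'"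
  by (metis keys_add_nat keys_mono_of sup_ge1)

lemma single_in_genideal_iff:
  assumes "\<And>y. y \<in> Y \<Longrightarrow> keys y \<subseteq> V" "keys x \<subseteq> V"
  shows "single x (1::'k::field) \<in> genideal (poly_ring V) ((\<lambda>x. single x 1) ` Y) \<longleftrightarrow> (\<exists>y\<in>Y. \<exists>z. x = y + z)"
  using assms(2) by (subst genideal_monomials) (auto simp: single_in_poly_ring dest: assms(1))

text \<open>Uniqueness: given another minimal monomial generating set with exponents
  \<open>Y\<close>, each x in \<open>X\<close> is a multiple of some y in \<open>Y\<close>, which is
  a multiple of some x' in \<open>X\<close>. The antichain property gives x' = x, hence y = x, so
  \<open>X\<close> is contained in \<open>Y\<close> and minimality gives equality.\<close>

lemma min_gens_antichain:
  fixes X :: "('v \<Rightarrow>\<^sub>0 nat) set"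
  assumes X: "\<And>x. x \<in> X \<Longrightarrow> keys x \<subseteq> V"
    and antichain: "\<And>x y z. x \<in> X \<Longrightarrow> y \<in> X \<Longrightarrow> y = x + z \<Longrightarrow> x = y"
  shows "min_gens V (genideal (poly_ring V) ((\<lambda>x. single x (1::'k::field)) ` X)) = (\<lambda>x. single x 1) ` X"
proof -
  define mnl where "mnl x = (single x 1 :: ('v, 'k) mpoly)" for x :: "'v \<Rightarrow>\<^sub>0 nat"
  have gen: "mnl x \<in> genideal (poly_ring V) (mnl ` Y) \<longleftrightarrow> (\<exists>y\<in>Y. \<exists>z. x = y + z)"
    if "\<And>y. y \<in> Y \<Longrightarrow> keys y \<subseteq> V" "keys x \<subseteq> V" for Y x
    unfolding mnl_def[abs_def] using that by (rule single_in_genideal_iff)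
  have "min_gens V (genideal (poly_ring V) (mnl ` X)) = mnl ` X"
    unfolding min_gens_def
  proof (rule the_equality)
    show "mnl ` X \<subseteq> monomials V \<and> genideal (poly_ring V) (mnl ` X) = genideal (poly_ring V) (mnl ` X) \<and>
      (\<forall>M'. M' \<subset> mnl ` X \<longrightarrow> genideal (poly_ring V) M' \<noteq> genideal (poly_ring V) (mnl ` X))"
    proof (intro conjI allI impI refl)
      show "mnl ` X \<subseteq> monomials V"
          unfolding mnl_def[abs_def] monomials_def using X by blast
      fix M' assume M': "M' \<subset> mnl ` X"
      then obtain X' where X': "X' \<subseteq> X" "M' = mnl ` X'"
        by (metis psubset_imp_subset subset_imageE)
      with M' obtain x where x: "x \<in> X" "x \<notin> X'"
        by blast
      have "mnl x \<in> genideal (poly_ring V) (mnl ` X)"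
        using X x(1) by (subst gen) (auto intro!: bexI[of _ x] exI[of _ 0])
      moreover have "mnl x \<notin> genideal (poly_ring V) (mnl ` X')"
      proof
        assume "mnl x \<in> genideal (poly_ring V) (mnl ` X')"
        then have "\<exists>y\<in>X'. \<exists>z. x = y + z"
          using X X'(1) x(1) by (subst gen[symmetric]) auto
        then obtain y z where y: "y \<in> X'" "x = y + z"
          by blast
        have "y = x"
          using X'(1) y(1) by (intro antichain[OF _ x(1) y(2)]) blast
        then show False
          using y(1) x(2) by simp
      qed
      ultimately show "genideal (poly_ring V) M' \<noteq> genideal (poly_ring V) (mnl ` X)"
        using X'(2) by blast
    qed
    fix M assume M: "M \<subseteq> monomials V \<and> genideal (poly_ring V) M = genideal (poly_ring V) (mnl ` X) \<and>
      (\<forall>M'. M' \<subset> M \<longrightarrow> genideal (poly_ring V) M' \<noteq> genideal (poly_ring V) (mnl ` X))"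
    define Y where "Y = {y. keys y \<subseteq> V \<and> mnl y \<in> M}"
    have MY: "M = mnl ` Y"
      using M by (auto simp: Y_def monomials_def mnl_def)
    have Y: "keys y \<subseteq> V" if "y \<in> Y" for y
      using that by (simp add: Y_def)
    have eq: "genideal (poly_ring V) (mnl ` Y) = genideal (poly_ring V) (mnl ` X)"
      using M MY by simp
    have "X \<subseteq> Y"
    proof
      fix x assume x: "x \<in> X"
      then have "mnl x \<in> genideal (poly_ring V) (mnl ` Y)"
        unfolding eq using X by (subst gen) (auto intro!: bexI[of _ x] exI[of _ 0])
      then have "\<exists>y\<in>Y. \<exists>z. x = y + z"
        using X[OF x] Y by (subst gen[symmetric]) auto
      then obtain y z where y: "y \<in> Y" "x = y + z"
        by blast
      then have "mnl y \<in> genideal (poly_ring V) (mnl ` X)"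
        unfolding eq[symmetric] using Y y(1) by (subst gen) (auto intro!: bexI[of _ y] exI[of _ 0])
      then have "\<exists>x\<in>X. \<exists>z. y = x + z"
        using X Y[OF y(1)] by (subst gen[symmetric]) auto
      then obtain x' z' where x': "x' \<in> X" "y = x' + z'"
        by blast
      have "x = x' + (z' + z)"
        using y(2) x'(2) by (simp add: add.assoc)
      then have "x' = x"
        by (rule antichain[OF x'(1) x])
      with \<open>x = x' + (z' + z)\<close> have "z' + z = 0"
        by (metis add_cancel_left_right)
      then have "keys z' \<union> keys z = {}"
        by (metis keys_add_nat keys_zero)
      then have "z' = 0"
        by (simp add: poly_mapping_eq_iff fun_eq_iff)
      then show "x \<in> Y"
        using x'(2) \<open>x' = x\<close> y(1) by simp
    qed
    moreover have "\<not> mnl ` X \<subset> mnl ` Y"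
      using M MY by blast
    ultimately show "M = mnl ` X"
      unfolding MY by blast
  qed
  then show ?thesis
    by (simp add: mnl_def[abs_def])
qed

lemma simple_graph_edgeD:
  assumes "simple_graph V E" "e \<in> E"
  shows "finite e" "e \<subseteq> V" "card e = 2"
  using assms by (auto simp: simple_graph_def complete_edges_def intro: finite_subset)

lemma edge_ideal_eq_xprod:
  assumes "simple_graph V E"
  shows "edge_ideal V E = (genideal (poly_ring V) (xprod ` E) :: ('v, 'k::field) mpoly set)"
proof -
  have "{xvar u * xvar v | u v. {u, v} \<in> E} = (xprod ` E :: ('v, 'k) mpoly set)"
  proof (intro equalityI subsetI)
    fix f :: "('v, 'k) mpoly" assume "f \<in> {xvar u * xvar v | u v. {u, v} \<in> E}"
    then obtain u v where uv: "f = xvar u * xvar v" "{u, v} \<in> E"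
      by blast
    then have "u \<noteq> v"
      using simple_graph_edgeD(3)[OF assms, of "{u, v}"] by auto
    then show "f \<in> xprod ` E"
      using uv by (intro image_eqI[of _ _ "{u, v}"]) (simp_all add: xprod_def)
  next
    fix f :: "('v, 'k) mpoly" assume "f \<in> xprod ` E"
    then obtain e where e: "e \<in> E" "f = xprod e"
      by blast
    then obtain u v where "e = {u, v}" "u \<noteq> v"
      using simple_graph_edgeE[OF assms] by metis
    with e show "f \<in> {xvar u * xvar v | u v. {u, v} \<in> E}"
      by (auto simp: xprod_def)
  qed
  then show ?thesis
    by (simp add: edge_ideal_def)
qed

text \<open>All edges have two elements, so no edge properly contains another and their products
  form an antichain under divisibility.\<close>

lemma min_gens_edge_ideal:
  assumes "simple_graph V E"
  shows "min_gens V (edge_ideal V E) = (xprod ` E :: ('v, 'k::field) mpoly set)"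
proof -
  have "min_gens V (genideal (poly_ring V) ((\<lambda>x. single x 1) ` mono_of ` E)) =
    ((\<lambda>x. single x 1) ` mono_of ` E :: ('v, 'k) mpoly set)"
  proof (rule min_gens_antichain)
    show "keys x \<subseteq> V" if "x \<in> mono_of ` E" for x
    proof -
      obtain e where "e \<in> E" "x = mono_of e"
        using \<open>x \<in> mono_of ` E\<close> by blast
      then show ?thesis
        using simple_graph_edgeD[OF assms, of e] by (simp add: keys_mono_of)
    qed
    show "x = y" if xy: "x \<in> mono_of ` E" "y \<in> mono_of ` E" "y = x + z" for x y z
    proof -
      obtain e e' where e: "e \<in> E" "x = mono_of e" "e' \<in> E" "y = mono_of e'"
        using xy by blast
      have "e \<subseteq> e'"
        using mono_of_dvdD[of e e' z] e xy(3) simple_graph_edgeD(1)[OF assms] by metis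
      moreover have "card e = card e'"
        using simple_graph_edgeD(3)[OF assms] e by metis
      ultimately have "e = e'"
        using simple_graph_edgeD(1)[OF assms e(3)] by (metis card_subset_eq)
      with e show ?thesis
        by simp
    qed
  qed
  then show ?thesis
    by (simp add: edge_ideal_eq_xprod[OF assms] image_image xprod_eq)
qed

lemma facet_complex_edge_ideal:
  assumes "simple_graph V E"
  shows "facet_complex V (edge_ideal V E :: ('v, 'k::field) mpoly set) = {A. \<exists>e\<in>E. A \<subseteq> e}"
proof -
  have "F \<in> E" if F: "F \<subseteq> V" "xprod F \<in> (xprod ` E :: ('v, 'k) mpoly set)" for F
  proof -
    obtain e where e: "e \<in> E" "(xprod F :: ('v, 'k) mpoly) = xprod e"
      using F(2) by blast
    have "keys (xprod F :: ('v, 'k) mpoly) = keys (xprod e :: ('v, 'k) mpoly)"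
      using e(2) by simp
    then have "keys (mono_of F) = keys (mono_of e)"
      by (simp add: xprod_eq)
    moreover have "finite F"
      using F(1) assms by (auto simp: simple_graph_def intro: finite_subset)
    ultimately show ?thesis
      using simple_graph_edgeD(1)[OF assms e(1)] e(1) by (simp add: keys_mono_of)
  qed
  then show ?thesis
    unfolding facet_complex_def min_gens_edge_ideal[OF assms]
    using simple_graph_edgeD(2)[OF assms] by blast
qed

lemma nonface_complex_edge_ideal:
  assumes "simple_graph V E"
  shows "nonface_complex V (edge_ideal V E :: ('v, 'k::field) mpoly set) = {F. F \<subseteq> V \<and> (\<forall>e\<in>E. \<not> e \<subseteq> F)}"
proof -
  have "(xprod F :: ('v, 'k) mpoly) \<in> edge_ideal V E \<longleftrightarrow> (\<exists>e\<in>E. e \<subseteq> F)" if F: "F \<subseteq> V" for F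
  proof -
    have "finite F"
      using F assms by (auto simp: simple_graph_def intro: finite_subset)
    then show ?thesis
      using F by (simp add: in_edge_ideal_iff[OF assms] xprod_eq in_poly_ring_iff keys_mono_of)
  qed
  then show ?thesis
    by (auto simp: nonface_complex_def)
qed

lemma f_vector_dim_1:
  assumes "\<And>F. F \<in> D \<Longrightarrow> card F \<le> 2" "F0 \<in> D" "card F0 = 2"
  shows "f_vector D = [int (card {F \<in> D. card F = 1}), int (card {F \<in> D. card F = 2})]"
proof -
  have sub: "card ` D \<subseteq> {..2}"
    using assms(1) by auto
  have "Max (insert 0 (card ` D)) = 2"
  proof (rule Max_eqI)
    show "finite (insert 0 (card ` D))"
      using finite_subset[OF sub] by simp
    show "y \<le> 2" if "y \<in> insert 0 (card ` D)" for y
      using that sub by auto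
    show "2 \<in> insert 0 (card ` D)"
      using assms(2,3) by force
  qed
  then show ?thesis
    by (simp add: f_vector_def upt_rec numeral_2_eq_2)
qed

lemma card_singletons: "card {F. F \<subseteq> V \<and> card F = 1} = card V"
proof -
  have "{F. F \<subseteq> V \<and> card F = 1} = (\<lambda>v. {v}) ` V"
    by (auto simp: card_1_singleton_iff)
  then show ?thesis
    by (simp add: card_image)
qed

lemma card_complete_edges: "finite V \<Longrightarrow> card (complete_edges V) = card V choose 2"
  by (simp add: complete_edges_def n_subsets)

text \<open>The last entry is the number of non-edges minus the number of edges. Having both an edge
  and a non-edge gives both f-vectors length two, and covering all vertices makes the first entries
  agree.\<close>

lemma quasi_f_graph_dim_1:
  fixes V :: "'v set" and E :: "'v set set"
  assumes simple: "simple_graph V E" and cover: "\<And>v. v \<in> V \<Longrightarrow> \<exists>e\<in>E. v \<in> e"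
    and no_triangle: "\<And>F. F \<subseteq> V \<Longrightarrow> (\<And>e. e \<in> E \<Longrightarrow> \<not> e \<subseteq> F) \<Longrightarrow> card F \<le> 2"
    and nonempty: "E \<noteq> {}" and nonedge: "e0 \<in> complete_edges V" "e0 \<notin> E"
  shows "quasi_f_graph TYPE('k::field) V E [0, int (card V choose 2) - 2 * int (card E)]"
proof -
  define D1 where "D1 = {F. F \<subseteq> V \<and> (\<forall>e\<in>E. \<not> e \<subseteq> F)}"
  define D2 where "D2 = {A. \<exists>e\<in>E. A \<subseteq> e}"
  note edge = simple_graph_edgeD[OF simple]
  have fin: "finite V" and sub: "E \<subseteq> complete_edges V"
    using simple by (auto simp: simple_graph_def)
  have fin_c: "finite (complete_edges V)"
    using fin by (simp add: complete_edges_def)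
  have edge_sub: "e = F" if "e \<in> E" "e \<subseteq> F" "card F = 2" for e F
  proof -
    have "finite F"
      using that(3) by (metis card.infinite zero_neq_numeral)
    then show ?thesis
      using that edge(3)[OF that(1)] by (metis card_subset_eq)
  qed
  have D1_1: "{F \<in> D1. card F = 1} = {F. F \<subseteq> V \<and> card F = 1}"
  proof -
    have "\<not> e \<subseteq> F" if "e \<in> E" "card F = 1" for e F
    proof
      assume "e \<subseteq> F"
      have "finite F"
        using that(2) by (metis card.infinite zero_neq_one)
      then have "card e \<le> card F"
        using \<open>e \<subseteq> F\<close> by (rule card_mono)
      then show False
        using that edge(3) by simp
    qed
    then show ?thesis
      by (auto simp: D1_def)
  qed
  have D1_2: "{F \<in> D1. card F = 2} = complete_edges V - E"
    using edge_sub by (auto simp: D1_def complete_edges_def)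
  have D2_1: "{F \<in> D2. card F = 1} = {F. F \<subseteq> V \<and> card F = 1}"
    using cover edge(2) by (auto simp: D2_def card_1_singleton_iff)
  have D2_2: "{F \<in> D2. card F = 2} = E"
  proof -
    have "F \<in> E" if "e \<in> E" "F \<subseteq> e" "card F = 2" for F e
      using that edge[OF that(1)] by (metis card_subset_eq)
    then show ?thesis
      using edge(3) by (auto simp: D2_def)
  qed
  obtain e1 where e1: "e1 \<in> E"
    using nonempty by blast
  have f1: "f_vector D1 = [int (card V), int (card (complete_edges V - E))]"
  proof -
    have "f_vector D1 = [int (card {F \<in> D1. card F = 1}), int (card {F \<in> D1. card F = 2})]"
    proof (rule f_vector_dim_1)
      show "card F \<le> 2" if "F \<in> D1" for F
        using that no_triangle by (simp add: D1_def)
      show "e0 \<in> D1" "card e0 = 2"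
        using nonedge D1_2 by blast+
    qed
    then show ?thesis
      by (simp only: D1_1 D1_2 card_singletons)
  qed
  have f2: "f_vector D2 = [int (card V), int (card E)]"
  proof -
    have "f_vector D2 = [int (card {F \<in> D2. card F = 1}), int (card {F \<in> D2. card F = 2})]"
    proof (rule f_vector_dim_1)
      show "card F \<le> 2" if "F \<in> D2" for F
        using that edge by (auto simp: D2_def) (metis card_mono)
      show "e1 \<in> D2" "card e1 = 2"
        using e1 edge(3) by (auto simp: D2_def)
    qed
    then show ?thesis
      by (simp only: D2_1 D2_2 card_singletons)
  qed
  have "card E \<le> card (complete_edges V)"
    using card_mono[OF fin_c sub] .
  then have card: "int (card (complete_edges V - E)) = int (card V choose 2) - int (card E)"
    using card_Diff_subset[OF finite_subset[OF sub fin_c] sub] by (simp add: card_complete_edges fin)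
  have "squarefree_monomial_ideal V (edge_ideal V E :: ('v, 'k) mpoly set)"
    unfolding squarefree_monomial_ideal_def edge_ideal_eq_xprod[OF simple]
    using edge(2) by (intro exI[of _ E]) auto
  then show ?thesis
    unfolding quasi_f_graph_def quasi_f_ideal_def nonface_complex_edge_ideal[OF simple]
      facet_complex_edge_ideal[OF simple] D1_def[symmetric] D2_def[symmetric]
    by (simp add: f1 f2 card)
qed

section \<open>Two complete graphs joined by few edges\<close>

lemma two_times_choose_two: "2 * int (m choose 2) = int m * (int m - 1)"
proof -
  have "even (m * (m - 1))"
    by (cases m) auto
  then have "2 * (m choose 2) = m * (m - 1)"
    by (simp add: choose_two)
  then have "2 * int (m choose 2) = int (m * (m - 1))"
    by (metis of_nat_mult of_nat_numeral)
  then show ?thesis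
    by (cases m) (simp_all add: algebra_simps)
qed

text \<open>The bound \<open>c < int q\<close> supplies the missing edges: if every vertex of
  \<open>V2\<close> were joined to u or u', choosing one such edge for each would use
  \<open>q\<close> joining edges, and a vertex of \<open>V2\<close> joined to all of
  \<open>V1\<close> would use \<open>p\<close>, which is at least \<open>q\<close>.\<close>

lemma joined_complete_graphs_CM_quasi_f:
  fixes E :: "'v set set"
  assumes joined: "joined_complete_graphs p q c V E" and graph: "simple_graph V E"
    and pq: "2 \<le> q" "q \<le> p" "c < int q"
    and b: "b = int ((p + q) choose 2) - 2 * (int (p choose 2) + int (q choose 2) + c)"
  shows "cohen_macaulay_graph TYPE('k::field) V E \<and> quasi_f_graph TYPE('k) V E [0, b]"
proof -
  obtain V1 V2 C where V: "V = V1 \<union> V2" "V1 \<inter> V2 = {}" "finite V1" "finite V2" "card V1 = p" "card V2 = q"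
    and C: "C \<subseteq> {{u, v} | u v. u \<in> V1 \<and> v \<in> V2}" "int (card C) = c"
    and E: "E = complete_edges V1 \<union> complete_edges V2 \<union> C"
    using joined unfolding joined_complete_graphs_def by (elim exE conjE) (rule that)
  have disj: "x \<noteq> y" if "x \<in> V1" "y \<in> V2" for x y
    using that V(2) by blast
  have finC: "finite C"
    by (rule finite_subset[OF C(1)], rule finite_subset[of _ "Pow (V1 \<union> V2)"]) (use V in auto)
  have in_C: "{u, v} \<in> C" if "u \<in> V1" "v \<in> V2" "{u, v} \<in> E" for u v
    using that V(2) unfolding E complete_edges_def by blast
  have common: "\<exists>v\<in>V2. {u, v} \<notin> E \<and> {u', v} \<notin> E" if u: "u \<in> V1" "u' \<in> V1" for u u'
  proof (rule ccontr)
    assume "\<not> ?thesis"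
    then have *: "{u, v} \<in> C \<or> {u', v} \<in> C" if "v \<in> V2" for v
      using that u in_C by blast
    define e where "e v = (if {u, v} \<in> C then {u, v} else {u', v})" for v
    have "inj_on e V2"
    proof (rule inj_onI)
      fix v w assume "v \<in> V2" "w \<in> V2" "e v = e w"
      moreover have "e x \<inter> V2 = {x}" if "x \<in> V2" for x
        using that u V(2) by (auto simp: e_def)
      ultimately show "v = w"
        by (metis singleton_inject)
    qed
    moreover have "e ` V2 \<subseteq> C"
      using * by (auto simp: e_def)
    ultimately have "q \<le> card C"
      using card_inj_on_le[of e V2 C] finC V(6) by simp
    then show False
      using C(2) pq(3) by simp
  qed
  have nonnb: "\<exists>u\<in>V1. {u, v} \<notin> E" if v: "v \<in> V2" for v
  proof (rule ccontr)
    assume "\<not> ?thesis"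
    then have "{u, v} \<in> C" if "u \<in> V1" for u
      using that v in_C by blast
    then have "(\<lambda>u. {u, v}) ` V1 \<subseteq> C"
      by blast
    moreover have "inj_on (\<lambda>u. {u, v}) V1"
      by (rule inj_onI) (metis doubleton_eq_iff)
    ultimately have "p \<le> card C"
      using card_inj_on_le[of "\<lambda>u. {u, v}" V1 C] finC V(5) by simp
    then show False
      using C(2) pq by simp
  qed
  have "V1 \<noteq> {}"
    using V(5) pq by auto
  interpret two_cliques V1 V2 E
    by unfold_locales (use V graph common nonnb \<open>V1 \<noteq> {}\<close> in \<open>auto simp: E\<close>)
  have V_eq: "two_cliques.V V1 V2 = V"
    by (simp add: V_def V(1))
  have cover: "\<exists>e\<in>E. v \<in> e" if "v \<in> V" for v
  proof -
    have two: "\<exists>e\<in>complete_edges W. v \<in> e" if vW: "v \<in> W" "card W \<ge> 2" for W :: "'v set"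
    proof -
      have "W \<noteq> {v}"
        using vW(2) by auto
      then obtain w where "w \<in> W" "w \<noteq> v"
        using vW(1) by blast
      then show ?thesis
        using vW(1) by (intro bexI[of _ "{v, w}"]) (auto simp: complete_edges_def)
    qed
    show ?thesis
      using that two[of V1] two[of V2] V pq unfolding E by auto
  qed
  have small: "card F \<le> 2" if F: "F \<subseteq> V" "\<And>e. e \<in> E \<Longrightarrow> \<not> e \<subseteq> F" for F
  proof -
    have "\<exists>(u, v)\<in>nonedges. F \<subseteq> {u, v}"
      using F V_eq by (intro independent_subset_nonedge) auto
    then obtain u v where uv: "F \<subseteq> {u, v}"
      by blast
    have "card F \<le> card {u, v}"
      by (rule card_mono[OF _ uv]) simp
    also have "\<dots> \<le> 2"
      by (simp add: card_insert_if)
    finally show ?thesis .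
  qed
  obtain u v where uv: "u \<in> V1" "v \<in> V2" "{u, v} \<notin> E"
    using \<open>V1 \<noteq> {}\<close> common by blast
  have "card (complete_edges V1 \<union> complete_edges V2 \<union> C) = (p choose 2) + (q choose 2) + card C"
  proof -
    have "complete_edges V1 \<inter> complete_edges V2 = {}"
    proof (rule equals0I)
      fix e assume "e \<in> complete_edges V1 \<inter> complete_edges V2"
      then have "e \<subseteq> V1 \<inter> V2" "card e = 2"
        unfolding complete_edges_def by blast+
      then show False
        unfolding V(2) by simp
    qed
    moreover have "(complete_edges V1 \<union> complete_edges V2) \<inter> C = {}"
      using C(1) V(2) by (auto simp: complete_edges_def)
    moreover have "finite (complete_edges V1)" "finite (complete_edges V2)"
      using V by (simp_all add: complete_edges_def)
    ultimately show ?thesis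
      using V finC by (simp add: card_Un_disjoint card_complete_edges)
  qed
  then have cardE: "int (card E) = int (p choose 2) + int (q choose 2) + c"
    using C(2) by (simp add: E)
  have cardV: "card V = p + q"
    using V by (simp add: card_Un_disjoint)
  have "quasi_f_graph TYPE('k) V E [0, int (card V choose 2) - 2 * int (card E)]"
  proof (rule quasi_f_graph_dim_1[OF graph])
    show "v \<in> V \<Longrightarrow> \<exists>e\<in>E. v \<in> e" for v
      by (rule cover)
    show "card F \<le> 2" if "F \<subseteq> V" "\<And>e. e \<in> E \<Longrightarrow> \<not> e \<subseteq> F" for F
      using that by (rule small)
    show "E \<noteq> {}"
      using cover uv V(1) by blast
    show "{u, v} \<in> complete_edges V" "{u, v} \<notin> E"
      using uv disj V(1) by (auto simp: complete_edges_def)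
  qed
  moreover have "cohen_macaulay_graph TYPE('k) V E"
    using cohen_macaulay_graph_two_cliques by (simp add: V(1))
  ultimately show ?thesis
    by (simp add: b cardE cardV)
qed

theorem theorem5p3:
  fixes n k :: nat and b b' :: int and V :: "'v set" and E :: "'v set set"
  assumes "n > 0"
    and "\<bar>b\<bar> < \<lfloor>real n / 2\<rfloor>"
    and "k > 0"
    and "simple_graph V E" and "card V = n"
    and "(n = 4 * k \<and> b = 2 * b' \<and>
            joined_complete_graphs (2 * k) (2 * k) (int k - b') V E) \<or>
         (n = 4 * k + 1 \<and> b = 2 * b' \<and>
            joined_complete_graphs (2 * k + 1) (2 * k) (int k - b') V E) \<or>
         (n = 4 * k + 2 \<and> b = 2 * b' + 1 \<and>
            joined_complete_graphs (2 * k + 1) (2 * k + 1) (int k - b') V E) \<or>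
         (n = 4 * k + 3 \<and> b = 2 * b' + 1 \<and>
            joined_complete_graphs (2 * k + 2) (2 * k + 1) (int k - b') V E)"
  shows "cohen_macaulay_graph TYPE('k::field) V E \<and> quasi_f_graph TYPE('k) V E [0, b]"
proof -
  have "\<bar>b\<bar> < int (n div 2)"
    using assms(2) floor_divide_of_nat_eq[of n 2, where ?'a = real] by simp
  \<comment> \<open>In each case \<open>q\<close> is \<open>n div 2\<close>, and b > -q is what
    yields \<open>int k - b' < int q\<close>.\<close>
  with assms(3,6) obtain p q where joined: "joined_complete_graphs p q (int k - b') V E"
    and pq: "2 \<le> q" "q \<le> p" "int k - b' < int q"
    and cases: "p = 2 * k \<and> q = 2 * k \<and> b = 2 * b' \<or> p = 2 * k + 1 \<and> q = 2 * k \<and> b = 2 * b' \<or>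
      p = 2 * k + 1 \<and> q = 2 * k + 1 \<and> b = 2 * b' + 1 \<or> p = 2 * k + 2 \<and> q = 2 * k + 1 \<and> b = 2 * b' + 1"
    by (elim disjE conjE) (rule that, assumption, linarith+, simp)+
  \<comment> \<open>With c = k - b' the right side is p + q - (p - q)^2 - 4c, that is 2q - 4c
    because p - q is 0 or 1. Doubling avoids the halves in the binomials.\<close>
  have "2 * b = 2 * (int ((p + q) choose 2) - 2 * (int (p choose 2) + int (q choose 2) + (int k - b')))"
    unfolding right_diff_distrib distrib_left mult.assoc[symmetric]
    using cases two_times_choose_two[of "p + q"] two_times_choose_two[of p] two_times_choose_two[of q]
    by (auto simp: algebra_simps)
  then have "b = int ((p + q) choose 2) - 2 * (int (p choose 2) + int (q choose 2) + (int k - b'))"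
    by (simp only: mult_cancel_left) simp
  then show ?thesis
    using joined_complete_graphs_CM_quasi_f[OF joined assms(4) pq] by blast
qed

end
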